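(* Let $\varphi:\,]a,b[\,\to\mathbb{R}$ be a strictly increasing function satisfying $$\ddot\varphi+\lambda\,\dot\varphi^2\ge 0\qquad\text{for some constant }\lambda>0,$$ and let $\psi:\Sigma\to\mathbb{R}^2\times]a,b[$ be a $2$-dimensional $[\varphi,\vec e_3]$-minimal immersion with $H\le 0$. If $H$ vanishes anywhere, then $H$ vanishes everywhere and $\psi(\Sigma)$ lies in a vertical plane.
   Context: The function $\varphi$ is smooth, and a dot denotes its derivative with respect to its (height) variable. The immersion $\psi$ of the surface $\Sigma$ (maybe with non-empty boundary) has Gauss map $N$ and vector-valued second fundamental form $\mathbf{A}$; its scalar second fundamental form is $\mathcal{A}(X,Y)=-\langle\mathbf{A}(X,Y),N\rangle$. The mean curvature vector $\mathbf{H}$ is the trace of $\mathbf{A}$, and the mean curvature function $H$ is the trace of $\mathcal{A}$, both with respect to the induced metric. The immersion is $[\varphi,\vec e_3]$-minimal if $\mathbf{H}=\dot\varphi\,\vec e_3^{\,\perp}$, where $\perp$ is the projection to the normal bundle, $\vec e_3=(0,0,1)$, and $\dot\varphi$ is evaluated at the height of the point; equivalently $H=-\dot\varphi\,\langle N,\vec e_3\rangle$.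
   Formalization: The surface is assumed connected, and "H vanishes anywhere" is read as vanishing at an interior point of Σ; for a zero only on the boundary the claim fails (upper half of a rotational wing-like translator cut at its neck, φ(z)=z). *)

theory Defs
  imports "HOL-Analysis.Analysis"
begin

section \<open>Smooth maps\<close>

text \<open>Derivatives are taken within the domain \<^term>\<open>D\<close>, which below is always open or relatively
  open in a closed half-plane. There the derivative within \<^term>\<open>D\<close> is unique; at points of the
  boundary line it is one-sided, so smoothness includes the boundary.\<close>

fun Ck_on :: "nat \<Rightarrow> ('v::real_normed_vector \<Rightarrow> 'w::real_normed_vector) \<Rightarrow> 'v set \<Rightarrow> bool" where
  "Ck_on 0 f D \<longleftrightarrow> continuous_on D f"
| "Ck_on (Suc k) f D \<longleftrightarrow>
     f differentiable_on D \<and>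
     (\<forall>v. Ck_on k (\<lambda>x. frechet_derivative f (at x within D) v) D)"

definition smooth_on :: "('v::real_normed_vector \<Rightarrow> 'w::real_normed_vector) \<Rightarrow> 'v set \<Rightarrow> bool" where
  "smooth_on f D \<longleftrightarrow> (\<forall>k. Ck_on k f D)"

section \<open>Smooth surfaces, possibly with boundary\<close>

type_synonym 'a chart = "'a set \<times> ('a \<Rightarrow> real^2)"

definition half_plane :: "(real^2) set" where
  "half_plane = {x. 0 \<le> x $ 1}"

abbreviation chart_image :: "'a chart \<Rightarrow> (real^2) set" where
  "chart_image c \<equiv> snd c ` fst c"

abbreviation chart_inv :: "'a chart \<Rightarrow> real^2 \<Rightarrow> 'a" where
  "chart_inv c \<equiv> inv_into (fst c) (snd c)"

definition surface_chart :: "'a topology \<Rightarrow> 'a chart \<Rightarrow> bool" where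
  "surface_chart S c \<longleftrightarrow>
     openin S (fst c) \<and>
     (open (chart_image c) \<or> openin (top_of_set half_plane) (chart_image c)) \<and>
     homeomorphic_map (subtopology S (fst c)) (top_of_set (chart_image c)) (snd c)"

text \<open>The atlas is not required to be maximal.\<close>

definition smooth_surface :: "'a topology \<Rightarrow> 'a chart set \<Rightarrow> bool" where
  "smooth_surface S \<A> \<longleftrightarrow>
     Hausdorff_space S \<and> second_countable S \<and>
     (\<forall>c\<in>\<A>. surface_chart S c) \<and>
     topspace S = (\<Union>c\<in>\<A>. fst c) \<and>
     (\<forall>c\<in>\<A>. \<forall>d\<in>\<A>. smooth_on (snd d \<circ> chart_inv c) (snd c ` (fst c \<inter> fst d)))"

text \<open>The interior of the surface as a manifold with boundary (all of it if there is no boundary).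
  In the condition below, \<^const>\<open>interior\<close> is the topological interior in the plane.\<close>

definition surface_interior :: "'a chart set \<Rightarrow> 'a set" where
  "surface_interior \<A> = {p. \<exists>c\<in>\<A>. p \<in> fst c \<and> snd c p \<in> interior (chart_image c)}"

definition smooth_map :: "'a chart set \<Rightarrow> ('a \<Rightarrow> 'w::real_normed_vector) \<Rightarrow> bool" where
  "smooth_map \<A> f \<longleftrightarrow> (\<forall>c\<in>\<A>. smooth_on (f \<circ> chart_inv c) (chart_image c))"

text \<open>The derivative of \<^term>\<open>f\<close> at \<^term>\<open>p\<close> along the vector field that is constantly \<^term>\<open>v\<close> in
  the coordinates of the chart \<^term>\<open>c\<close>.\<close>

definition chart_deriv :: "'a chart \<Rightarrow> real^2 \<Rightarrow> ('a \<Rightarrow> 'w::real_normed_vector) \<Rightarrow> 'a \<Rightarrow> 'w" where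
  "chart_deriv c v f p =
     frechet_derivative (f \<circ> chart_inv c) (at (snd c p) within chart_image c) v"

section \<open>Extrinsic geometry of an immersed surface\<close>

text \<open>A tangent vector at a point of the domain of a chart \<^term>\<open>c\<close> is represented by its coordinate
  vector in \<^typ>\<open>real^2\<close>.\<close>

definition immersion :: "'a chart set \<Rightarrow> ('a \<Rightarrow> real^3) \<Rightarrow> bool" where
  "immersion \<A> \<psi> \<longleftrightarrow>
     smooth_map \<A> \<psi> \<and> (\<forall>c\<in>\<A>. \<forall>p\<in>fst c. inj (\<lambda>v. chart_deriv c v \<psi> p))"

definition tangent_plane :: "'a chart \<Rightarrow> ('a \<Rightarrow> real^3) \<Rightarrow> 'a \<Rightarrow> (real^3) set" where
  "tangent_plane c \<psi> p = range (\<lambda>v. chart_deriv c v \<psi> p)"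

definition normal_part :: "(real^3) set \<Rightarrow> real^3 \<Rightarrow> real^3" where
  "normal_part T w = (THE n. (\<forall>t\<in>T. n \<bullet> t = 0) \<and> w - n \<in> T)"

definition gauss_map :: "'a chart set \<Rightarrow> ('a \<Rightarrow> real^3) \<Rightarrow> ('a \<Rightarrow> real^3) \<Rightarrow> bool" where
  "gauss_map \<A> \<psi> N \<longleftrightarrow>
     smooth_map \<A> N \<and>
     (\<forall>c\<in>\<A>. \<forall>p\<in>fst c. norm (N p) = 1 \<and> (\<forall>t\<in>tangent_plane c \<psi> p. N p \<bullet> t = 0))"

definition induced_metric :: "'a chart \<Rightarrow> ('a \<Rightarrow> real^3) \<Rightarrow> 'a \<Rightarrow> real^2 \<Rightarrow> real^2 \<Rightarrow> real" where
  "induced_metric c \<psi> p u v = chart_deriv c u \<psi> p \<bullet> chart_deriv c v \<psi> p"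

definition vector_sff :: "'a chart \<Rightarrow> ('a \<Rightarrow> real^3) \<Rightarrow> 'a \<Rightarrow> real^2 \<Rightarrow> real^2 \<Rightarrow> real^3" where
  "vector_sff c \<psi> p u v =
     normal_part (tangent_plane c \<psi> p) (chart_deriv c u (chart_deriv c v \<psi>) p)"

definition scalar_sff ::
  "'a chart \<Rightarrow> ('a \<Rightarrow> real^3) \<Rightarrow> ('a \<Rightarrow> real^3) \<Rightarrow> 'a \<Rightarrow> real^2 \<Rightarrow> real^2 \<Rightarrow> real" where
  "scalar_sff c \<psi> N p u v = - (vector_sff c \<psi> p u v \<bullet> N p)"

text \<open>The trace of a bilinear form with respect to a metric: the contraction of its coefficients with
  the inverse Gram matrix.\<close>

definition metric_trace ::
  "(real^2 \<Rightarrow> real^2 \<Rightarrow> real) \<Rightarrow> (real^2 \<Rightarrow> real^2 \<Rightarrow> 'w::real_vector) \<Rightarrow> 'w" where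
  "metric_trace g B =
     (let G = (\<chi> i j. g (axis i 1) (axis j 1)) :: real^2^2
      in \<Sum>i\<in>UNIV. \<Sum>j\<in>UNIV. matrix_inv G $ i $ j *\<^sub>R B (axis i 1) (axis j 1))"

definition mean_curvature_vector :: "'a chart \<Rightarrow> ('a \<Rightarrow> real^3) \<Rightarrow> 'a \<Rightarrow> real^3" where
  "mean_curvature_vector c \<psi> p = metric_trace (induced_metric c \<psi> p) (vector_sff c \<psi> p)"

text \<open>The trace does not depend on the chart, so any chart around \<^term>\<open>p\<close> may be used.\<close>

definition mean_curvature ::
  "'a chart set \<Rightarrow> ('a \<Rightarrow> real^3) \<Rightarrow> ('a \<Rightarrow> real^3) \<Rightarrow> 'a \<Rightarrow> real" where
  "mean_curvature \<A> \<psi> N p =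
     (let c = (SOME c. c \<in> \<A> \<and> p \<in> fst c)
      in metric_trace (induced_metric c \<psi> p) (scalar_sff c \<psi> N p))"

definition e3 :: "real^3" where
  "e3 = axis 3 1"

text \<open>The equation \<open>H = \<phi>' e3\<^sup>\<bottom>\<close> for the mean curvature vector, in all charts.\<close>

definition minimal_immersion :: "(real \<Rightarrow> real) \<Rightarrow> 'a chart set \<Rightarrow> ('a \<Rightarrow> real^3) \<Rightarrow> bool" where
  "minimal_immersion \<phi> \<A> \<psi> \<longleftrightarrow>
     immersion \<A> \<psi> \<and>
     (\<forall>c\<in>\<A>. \<forall>p\<in>fst c.
        mean_curvature_vector c \<psi> p =
        deriv \<phi> (\<psi> p $ 3) *\<^sub>R normal_part (tangent_plane c \<psi> p) e3)"

definition vertical_plane :: "(real^3) set \<Rightarrow> bool" where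
  "vertical_plane P \<longleftrightarrow> (\<exists>n d. n \<noteq> 0 \<and> n \<bullet> e3 = 0 \<and> P = {x. n \<bullet> x = d})"

end

theory Submission
  imports Defs
begin

text \<open>The hypothesis on \<open>\<phi>\<close> makes \<open>exp (lam * \<phi>)\<close> convex, and since it is strictly increasing, \<open>\<phi>'\<close> is
  positive. Pairing the mean curvature equation with the unit normal gives \<open>H = - \<phi>' * \<nu>\<close> for the
  angle function \<open>\<nu> = N \<bullet> e3\<close>, so \<open>\<nu> \<ge> 0\<close>, and \<open>\<nu>\<close> vanishes where \<open>H\<close> does. The traced Codazzi
  equation shows that \<open>\<nu>\<close> solves a linear elliptic equation
  \<open>\<Delta>\<nu> + \<phi>' \<langle>\<nabla>\<mu>, \<nabla>\<nu>\<rangle> + (|A|\<^sup>2 + \<phi>'' |\<nabla>\<mu>|\<^sup>2) \<nu> = 0\<close>, where \<open>\<mu>\<close> is the height. For a nonnegative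
  solution the strong maximum principle needs no sign of the zeroth order coefficient, so an interior
  zero of \<open>\<nu>\<close> forces \<open>\<nu> = 0\<close> on the whole connected surface; boundary points are reached by continuity
  from the interior of convex coordinate patches. Then \<open>e3\<close> is tangent and lies in the kernel of the
  second fundamental form, which is trace-free, hence zero. So \<open>N\<close> is a constant horizontal vector
  and \<open>\<psi> \<bullet> N\<close> is constant.\<close>

section \<open>Partial derivatives and the strong maximum principle\<close>

text \<open>Laplacian and gradient are never formed. Everything is written in the coordinates of a
  patch and multiplied by powers of the Gram determinant, so the equation for the angle function
  becomes a polynomial identity in inner products; the version proved is \<Delta>^2 times the
  invariant one. Codazzi comes from differentiating the symmetry of the second fundamental form,
  which spares covariant derivatives and third derivatives of the immersion. The zeroth order
  coefficient may have either sign because the barrier comparison only looks at a point where the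
  solution lies below a multiple of a Gaussian. There the zeroth order term is at most a constant
  times that Gaussian, and a steep Gaussian has a larger second order part. The boundary is the
  other obstacle: the maximum principle says nothing about a boundary zero. What is propagated is
  therefore not the zero set but the open set of points having a whole neighbourhood of zeros,
  seeded by the interior zero.\<close>

text \<open>The difference quotient is symmetric in \<open>u\<close> and \<open>v\<close>, so its
  limit identifies the two mixed derivatives. Differentiability of \<open>f' _ u\<close> at the
  single point \<open>x\<close> is enough; no continuity of second derivatives enters.\<close>

lemma second_difference_limit:
  fixes f :: "'a::real_normed_vector \<Rightarrow> real"
  assumes D: "open D" "x \<in> D"
    and f: "\<And>y. y \<in> D \<Longrightarrow> (f has_derivative f' y) (at y)"
    and L: "((\<lambda>y. f' y u) has_derivative L) (at x)"
  shows "((\<lambda>t. (f (x + t *\<^sub>R u + t *\<^sub>R v) - f (x + t *\<^sub>R u) - f (x + t *\<^sub>R v) + f x) / t\<^sup>2)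
           \<longlongrightarrow> L v) (at_right 0)"
proof (rule tendstoI)
  fix e :: real assume e: "e > 0"
  \<comment> \<open>The errors \<open>A\<close> and \<open>B\<close> below contribute
    \<open>norm u + norm v\<close> and \<open>norm u\<close>; the summand 1 keeps \<open>K\<close>
    positive, and the 2 in \<open>e'\<close> makes the total at most \<open>e / 2\<close>.\<close>
  define K where "K = 2 * norm u + norm v + 1"
  have K: "K > 0" by (simp add: K_def add_nonneg_pos)
  define e' where "e' = e / (2 * K)"
  have e': "e' > 0" using e K by (simp add: e'_def)
  obtain d1 where d1: "d1 > 0"
      "\<And>y. norm (y - x) < d1 \<Longrightarrow> norm (f' y u - f' x u - L (y - x)) \<le> e' * norm (y - x)"
    using L e' unfolding has_derivative_at_alt by blast
  obtain d2 where d2: "d2 > 0" "ball x d2 \<subseteq> D" using D open_contains_ball by blast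
  define d where "d = min d1 d2 / K"
  have d: "d > 0" using d1 d2 K by (simp add: d_def)
  interpret L: bounded_linear L using L by (rule has_derivative_bounded_linear)
  have key: "dist ((f (x + t *\<^sub>R u + t *\<^sub>R v) - f (x + t *\<^sub>R u) - f (x + t *\<^sub>R v) + f x) / t\<^sup>2) (L v) < e"
    if t: "0 < t" "t < d" for t
  proof -
    have small: "norm (s *\<^sub>R u + r *\<^sub>R v) < min d1 d2" if "0 \<le> s" "s \<le> t" "0 \<le> r" "r \<le> t" for s r
    proof -
      have "norm (s *\<^sub>R u + r *\<^sub>R v) \<le> s * norm u + r * norm v"
        using that norm_triangle_ineq[of "s *\<^sub>R u" "r *\<^sub>R v"] by simp
      also have "\<dots> \<le> t * norm u + t * norm v"
        using that by (intro add_mono mult_right_mono) auto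
      also have "\<dots> \<le> t * K" using t unfolding K_def by (simp add: algebra_simps)
      also have "\<dots> < min d1 d2" using t K unfolding d_def by (simp add: field_simps)
      finally show ?thesis .
    qed
    have inD: "x + s *\<^sub>R u + r *\<^sub>R v \<in> D" if "0 \<le> s" "s \<le> t" "0 \<le> r" "r \<le> t" for s r
    proof -
      have "dist (x + s *\<^sub>R u + r *\<^sub>R v) x < d2"
        using small[OF that] by (simp add: dist_norm add.assoc)
      then have "x + s *\<^sub>R u + r *\<^sub>R v \<in> ball x d2" by (simp only: mem_ball dist_commute)
      then show ?thesis using d2 by blast
    qed
    \<comment> \<open>The second difference is \<open>g t - g 0\<close>, so one use of the mean
      value theorem reduces it to first derivatives.\<close>
    define g where "g s = f (x + s *\<^sub>R u + t *\<^sub>R v) - f (x + s *\<^sub>R u)" for s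
    have lin: "f' y (r *\<^sub>R u) = r * f' y u" if "y \<in> D" for y r
      using linear_scale[OF has_derivative_linear[OF f[OF that]], of r u] by simp
    have g': "(g has_derivative (\<lambda>r. r * (f' (x + s *\<^sub>R u + t *\<^sub>R v) u - f' (x + s *\<^sub>R u) u))) (at s)"
      if s: "0 \<le> s" "s \<le> t" for s
    proof -
      have i1: "x + s *\<^sub>R u + t *\<^sub>R v \<in> D" and i2: "x + s *\<^sub>R u \<in> D"
        using inD[OF s, of t] inD[OF s, of 0] t by auto
      have a1: "((\<lambda>s. f (x + s *\<^sub>R u + t *\<^sub>R v)) has_derivative (\<lambda>r. f' (x + s *\<^sub>R u + t *\<^sub>R v) (r *\<^sub>R u))) (at s)"
        by (rule has_derivative_compose[of "\<lambda>s. x + s *\<^sub>R u + t *\<^sub>R v" "\<lambda>r. r *\<^sub>R u" _ _ f])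
           (auto intro!: derivative_eq_intros f i1)
      have a2: "((\<lambda>s. f (x + s *\<^sub>R u)) has_derivative (\<lambda>r. f' (x + s *\<^sub>R u) (r *\<^sub>R u))) (at s)"
        by (rule has_derivative_compose[of "\<lambda>s. x + s *\<^sub>R u" "\<lambda>r. r *\<^sub>R u" _ _ f])
           (auto intro!: derivative_eq_intros f i2)
      show ?thesis unfolding g_def
        using has_derivative_diff[OF a1 a2] lin[OF i1] lin[OF i2] by (simp add: algebra_simps)
    qed
    have gw: "(g has_derivative (\<lambda>r. r * (f' (x + s *\<^sub>R u + t *\<^sub>R v) u - f' (x + s *\<^sub>R u) u))) (at s within {0..t})"
      if "0 \<le> s" "s \<le> t" for s
      using g'[OF that] by (rule has_derivative_at_withinI)
    obtain \<xi> where xi: "0 < \<xi>" "\<xi> < t"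
        "g t - g 0 = (t - 0) * (f' (x + \<xi> *\<^sub>R u + t *\<^sub>R v) u - f' (x + \<xi> *\<^sub>R u) u)"
      using mvt_simple[OF t(1) gw] by auto
    \<comment> \<open>Linearisation errors of \<open>f' _ u\<close> at the two points; the linear
      parts differ by exactly \<open>L (t *\<^sub>R v)\<close>.\<close>
    define A where "A = f' (x + \<xi> *\<^sub>R u + t *\<^sub>R v) u - f' x u - L (\<xi> *\<^sub>R u + t *\<^sub>R v)"
    define B where "B = f' (x + \<xi> *\<^sub>R u) u - f' x u - L (\<xi> *\<^sub>R u)"
    have A: "\<bar>A\<bar> \<le> e' * (t * (norm u + norm v))"
    proof -
      have "\<bar>A\<bar> \<le> e' * norm (\<xi> *\<^sub>R u + t *\<^sub>R v)"
        using d1(2)[of "x + \<xi> *\<^sub>R u + t *\<^sub>R v"] small[of \<xi> t] xi t unfolding A_def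
        by (simp add: algebra_simps)
      also have "norm (\<xi> *\<^sub>R u + t *\<^sub>R v) \<le> t * norm u + t * norm v"
        by (rule order_trans[OF norm_triangle_ineq]) (use xi t in \<open>auto intro!: mult_right_mono\<close>)
      finally show ?thesis using e' by (simp add: algebra_simps)
    qed
    have B: "\<bar>B\<bar> \<le> e' * (t * norm u)"
    proof -
      have "\<bar>B\<bar> \<le> e' * norm (\<xi> *\<^sub>R u)"
        using d1(2)[of "x + \<xi> *\<^sub>R u"] small[of \<xi> 0] xi t unfolding B_def
        by simp
      also have "norm (\<xi> *\<^sub>R u) \<le> t * norm u"
        using xi t by (auto intro!: mult_right_mono)
      finally show ?thesis using e' by (simp add: algebra_simps)
    qed
    have "g t - g 0 = t * (t * L v + (A - B))"
      unfolding xi(3) A_def B_def by (simp add: L.add L.scaleR algebra_simps)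
    moreover have "t * (t * l + r) / t\<^sup>2 - l = r / t" for l r
      using t by (simp add: power2_eq_square field_simps)
    ultimately have "(g t - g 0) / t\<^sup>2 - L v = (A - B) / t" by simp
    moreover have "g t - g 0 = f (x + t *\<^sub>R u + t *\<^sub>R v) - f (x + t *\<^sub>R u) - f (x + t *\<^sub>R v) + f x"
      by (simp add: g_def)
    moreover have "\<bar>(A - B) / t\<bar> < e"
    proof -
      have "\<bar>A - B\<bar> \<le> e' * (t * (2 * norm u + norm v))" using A B by (simp add: algebra_simps)
      also have "\<dots> \<le> e' * (t * K)" unfolding K_def using e' t by (intro mult_left_mono) auto
      also have "\<dots> = e / 2 * t" using K by (simp add: e'_def)
      also have "\<dots> < e * t" using e t by simp
      finally show ?thesis using t by (simp add: field_simps abs_divide)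
    qed
    ultimately show ?thesis by (simp add: dist_real_def)
  qed
  show "\<forall>\<^sub>F t in at_right 0. dist ((f (x + t *\<^sub>R u + t *\<^sub>R v) - f (x + t *\<^sub>R u) - f (x + t *\<^sub>R v) + f x) / t\<^sup>2) (L v) < e"
    unfolding eventually_at_right_field using d key by blast
qed

lemma symmetric_second_derivative_real:
  fixes f :: "'a::real_normed_vector \<Rightarrow> real"
  assumes D: "open D" "x \<in> D"
    and f: "\<And>y. y \<in> D \<Longrightarrow> (f has_derivative f' y) (at y)"
    and L: "((\<lambda>y. f' y u) has_derivative L) (at x)"
    and M: "((\<lambda>y. f' y v) has_derivative M) (at x)"
  shows "L v = M u"
proof (rule tendsto_unique[OF _ second_difference_limit[OF D f L]])
  have "x + t *\<^sub>R v + t *\<^sub>R u = x + t *\<^sub>R u + t *\<^sub>R v" for t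
    by (simp add: add.assoc add.commute)
  then show "((\<lambda>t. (f (x + t *\<^sub>R u + t *\<^sub>R v) - f (x + t *\<^sub>R u) - f (x + t *\<^sub>R v) + f x) / t\<^sup>2)
           \<longlongrightarrow> M u) (at_right 0)"
    using second_difference_limit[OF D f M, of u] by (simp add: algebra_simps)
qed auto

lemma symmetric_second_derivative:
  fixes f :: "'a::real_normed_vector \<Rightarrow> 'b::real_inner"
  assumes D: "open D" "x \<in> D"
    and f: "\<And>y. y \<in> D \<Longrightarrow> (f has_derivative f' y) (at y)"
    and L: "((\<lambda>y. f' y u) has_derivative L) (at x)"
    and M: "((\<lambda>y. f' y v) has_derivative M) (at x)"
  shows "L v = M u"
proof -
  have "w \<bullet> L v = w \<bullet> M u" for w
    by (rule symmetric_second_derivative_real[OF D, of "\<lambda>y. w \<bullet> f y" "\<lambda>y h. w \<bullet> f' y h"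
          u "\<lambda>h. w \<bullet> L h" v "\<lambda>h. w \<bullet> M h"])
       (auto intro!: has_derivative_inner_right f L M)
  then show ?thesis using vector_eq_ldot by blast
qed


section \<open>Calculus of partial derivatives and 2-jets in the plane\<close>

text \<open>Stronger than the existence of partial derivatives: \<open>f\<close> is totally
  differentiable at \<open>x\<close>, with these two coefficients.\<close>

definition has_partials ::
  "(real^2 \<Rightarrow> 'b::real_normed_vector) \<Rightarrow> 'b \<Rightarrow> 'b \<Rightarrow> real^2 \<Rightarrow> bool" where
  "has_partials f f1 f2 x \<longleftrightarrow> (f has_derivative (\<lambda>h. h$1 *\<^sub>R f1 + h$2 *\<^sub>R f2)) (at x)"

lemma has_partials_unique:
  assumes "has_partials f a b x" "has_partials f a' b' x"
  shows "a = a'" "b = b'"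
proof -
  have eq: "h$1 *\<^sub>R a + h$2 *\<^sub>R b = h$1 *\<^sub>R a' + h$2 *\<^sub>R b'" for h :: "real^2"
    by (rule fun_cong[OF has_derivative_unique[OF assms[unfolded has_partials_def]]])
  show "a = a'" using eq[of "axis 1 1"] by (simp add: axis_def)
  show "b = b'" using eq[of "axis 2 1"] by (simp add: axis_def)
qed

lemma has_partials_transform:
  assumes "has_partials f a b x" "open D" "x \<in> D" "\<And>y. y \<in> D \<Longrightarrow> f y = g y"
  shows "has_partials g a b x"
  using assms unfolding has_partials_def by (rule has_derivative_transform_within_open)

lemma has_partials_const: "has_partials (\<lambda>_. c) 0 0 x"
  by (simp add: has_partials_def)

lemma has_partials_diff:
  assumes "has_partials f f1 f2 x" "has_partials g g1 g2 x"
  shows "has_partials (\<lambda>x. f x - g x) (f1 - g1) (f2 - g2) x"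
  unfolding has_partials_def
  by (rule has_derivative_eq_rhs[OF has_derivative_diff[OF assms[unfolded has_partials_def]]])
     (simp add: algebra_simps)

lemma has_partials_add:
  assumes "has_partials f f1 f2 x" "has_partials g g1 g2 x"
  shows "has_partials (\<lambda>x. f x + g x) (f1 + g1) (f2 + g2) x"
  unfolding has_partials_def
  by (rule has_derivative_eq_rhs[OF has_derivative_add[OF assms[unfolded has_partials_def]]])
     (simp add: algebra_simps)

lemma has_partials_inner:
  assumes "has_partials f f1 f2 x" "has_partials g g1 g2 x"
  shows "has_partials (\<lambda>x. f x \<bullet> g x) (f1 \<bullet> g x + f x \<bullet> g1) (f2 \<bullet> g x + f x \<bullet> g2) x"
  unfolding has_partials_def
  by (rule has_derivative_eq_rhs[OF has_derivative_inner[OF assms[unfolded has_partials_def]]])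
     (simp add: inner_simps algebra_simps)

lemma has_partials_mult:
  fixes f g :: "real^2 \<Rightarrow> real"
  assumes "has_partials f f1 f2 x" "has_partials g g1 g2 x"
  shows "has_partials (\<lambda>x. f x * g x) (f1 * g x + f x * g1) (f2 * g x + f x * g2) x"
  using has_partials_inner[OF assms] by simp

lemma has_partials_scaleR:
  assumes "has_partials f f1 f2 x"
  shows "has_partials (\<lambda>x. c *\<^sub>R f x) (c *\<^sub>R f1) (c *\<^sub>R f2) x"
  unfolding has_partials_def
  by (rule has_derivative_eq_rhs[OF has_derivative_scaleR_right[OF assms[unfolded has_partials_def]]])
     (simp add: algebra_simps)

lemma has_partials_compose_real:
  fixes f :: "real^2 \<Rightarrow> real"
  assumes "has_partials f f1 f2 x" "(p has_real_derivative p') (at (f x))"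
  shows "has_partials (\<lambda>x. p (f x)) (p' * f1) (p' * f2) x"
  unfolding has_partials_def
  by (rule has_derivative_eq_rhs[OF has_derivative_compose[OF assms(1)[unfolded has_partials_def]
        assms(2)[unfolded has_field_derivative_def]]])
     (simp add: algebra_simps)

text \<open>\<open>u12\<close> serves both as a derivative of \<open>u1\<close> and as one of
  \<open>u2\<close>, so the symmetry of mixed derivatives is built in.\<close>

definition has_jet2_on ::
  "(real^2 \<Rightarrow> 'b::real_normed_vector) \<Rightarrow> (real^2 \<Rightarrow> 'b) \<Rightarrow> (real^2 \<Rightarrow> 'b) \<Rightarrow>
   (real^2 \<Rightarrow> 'b) \<Rightarrow> (real^2 \<Rightarrow> 'b) \<Rightarrow> (real^2 \<Rightarrow> 'b) \<Rightarrow> (real^2) set \<Rightarrow> bool" where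
  "has_jet2_on u u1 u2 u11 u12 u22 D \<longleftrightarrow>
     (\<forall>x\<in>D. has_partials u (u1 x) (u2 x) x \<and>
            has_partials u1 (u11 x) (u12 x) x \<and>
            has_partials u2 (u12 x) (u22 x) x)"

lemma has_jet2_onD:
  assumes "has_jet2_on u u1 u2 u11 u12 u22 D" "x \<in> D"
  shows "has_partials u (u1 x) (u2 x) x" "has_partials u1 (u11 x) (u12 x) x"
    "has_partials u2 (u12 x) (u22 x) x"
  using assms by (auto simp: has_jet2_on_def)

lemma has_jet2_on_real_iff:
  fixes u :: "real^2 \<Rightarrow> real"
  shows "has_jet2_on u u1 u2 u11 u12 u22 D \<longleftrightarrow>
     (\<forall>x\<in>D. (u has_derivative (\<lambda>h. h$1 * u1 x + h$2 * u2 x)) (at x) \<and>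
            (u1 has_derivative (\<lambda>h. h$1 * u11 x + h$2 * u12 x)) (at x) \<and>
            (u2 has_derivative (\<lambda>h. h$1 * u12 x + h$2 * u22 x)) (at x))"
  unfolding has_jet2_on_def has_partials_def by simp

lemma has_jet2_on_inner:
  assumes "has_jet2_on u u1 u2 u11 u12 u22 D"
  shows "has_jet2_on (\<lambda>x. u x \<bullet> e) (\<lambda>x. u1 x \<bullet> e) (\<lambda>x. u2 x \<bullet> e)
    (\<lambda>x. u11 x \<bullet> e) (\<lambda>x. u12 x \<bullet> e) (\<lambda>x. u22 x \<bullet> e) D"
  using has_partials_inner[OF has_jet2_onD(1)[OF assms] has_partials_const]
    has_partials_inner[OF has_jet2_onD(2)[OF assms] has_partials_const]
    has_partials_inner[OF has_jet2_onD(3)[OF assms] has_partials_const]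
  unfolding has_jet2_on_def by simp

lemma has_jet2_on_subset:
  "has_jet2_on u u1 u2 u11 u12 u22 D \<Longrightarrow> E \<subseteq> D \<Longrightarrow> has_jet2_on u u1 u2 u11 u12 u22 E"
  unfolding has_jet2_on_def by blast

lemma has_jet2_on_continuous:
  "has_jet2_on u u1 u2 u11 u12 u22 D \<Longrightarrow> continuous_on D u"
  "has_jet2_on u u1 u2 u11 u12 u22 D \<Longrightarrow> continuous_on D u1"
  "has_jet2_on u u1 u2 u11 u12 u22 D \<Longrightarrow> continuous_on D u2"
  unfolding has_jet2_on_def has_partials_def
  by (meson continuous_at_imp_continuous_on has_derivative_continuous)+

section \<open>Necessary conditions at a minimum, and the Gaussian barrier\<close>

text \<open>Along the line through \<open>z\<close> in direction \<open>v\<close>, a negative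
  \<open>L v\<close> would make the slope negative right after \<open>z\<close>, and by the mean
  value theorem \<open>g\<close> would drop below its minimum.\<close>

lemma second_derivative_nonneg_at_min:
  fixes g :: "'a::real_normed_vector \<Rightarrow> real"
  assumes W: "open W" "z \<in> W" and min: "\<And>y. y \<in> W \<Longrightarrow> g z \<le> g y"
    and g': "\<And>y. y \<in> W \<Longrightarrow> (g has_derivative g' y) (at y)"
    and L: "((\<lambda>y. g' y v) has_derivative L) (at z)"
  shows "g' z = (\<lambda>_. 0)" "0 \<le> L v"
proof -
  obtain d0 where d0: "d0 > 0" "ball z d0 \<subseteq> W" using W open_contains_ball by blast
  show g'z: "g' z = (\<lambda>_. 0)"
    by (rule differential_zero_maxmin[OF W(2) W(1) g'[OF W(2)]]) (use min in auto)
  show "0 \<le> L v"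
  proof (rule ccontr)
    assume "\<not> 0 \<le> L v"
    then have neg: "L v < 0" by simp
    have line: "((\<lambda>s. z + s *\<^sub>R v) has_derivative (\<lambda>r. r *\<^sub>R v)) (at t)" for t
      by (auto intro!: derivative_eq_intros)
    have "((\<lambda>s. g' (z + s *\<^sub>R v) v) has_derivative (\<lambda>r. L (r *\<^sub>R v))) (at 0)"
      by (rule has_derivative_compose[OF line]) (use L in simp)
    moreover have "L (r *\<^sub>R v) = L v * r" for r
      using linear_scale[OF has_derivative_linear[OF L]] by simp
    ultimately have der: "((\<lambda>s. g' (z + s *\<^sub>R v) v) has_real_derivative L v) (at 0)"
      by (simp add: has_field_derivative_def)
    obtain d1 where d1: "d1 > 0" "\<And>h. 0 < h \<Longrightarrow> h < d1 \<Longrightarrow> g' (z + h *\<^sub>R v) v < 0"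
      using DERIV_neg_dec_right[OF der neg] g'z by auto
    \<comment> \<open>The first bound keeps the slope negative up to \<open>t\<close>, the second
      keeps the segment in \<open>W\<close>; the summand 1 covers \<open>v = 0\<close>.\<close>
    define t where "t = min (d1 / 2) (d0 / (2 * (norm v + 1)))"
    have t: "0 < t" using d1 d0 by (auto simp: t_def min_def add_nonneg_pos)
    have "t \<le> d1 / 2" unfolding t_def by (rule min.cobounded1)
    then have td1: "t < d1" using d1 by simp
    have tn: "t * (norm v + 1) \<le> d0 / 2"
    proof -
      have "t * (norm v + 1) \<le> d0 / (2 * (norm v + 1)) * (norm v + 1)"
        by (intro mult_right_mono) (auto simp: t_def)
      also have "\<dots> = d0 / 2"
      proof -
        have "norm v + 1 \<noteq> 0" using norm_ge_zero[of v] by linarith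
        moreover have "r / (2 * l) * l = r / 2" if "l \<noteq> 0" for r l :: real using that by simp
        ultimately show ?thesis by blast
      qed
      finally show ?thesis .
    qed
    have inW: "z + s *\<^sub>R v \<in> W" if "0 \<le> s" "s \<le> t" for s
    proof -
      have "s * norm v \<le> t * (norm v + 1)" using that t by (intro mult_mono) auto
      then have "dist z (z + s *\<^sub>R v) < d0" using tn d0 that by (simp add: dist_norm)
      then show ?thesis using d0 by auto
    qed
    have lin: "g' y (r *\<^sub>R v) = r * g' y v" if "y \<in> W" for y r
      using linear_scale[OF has_derivative_linear[OF g'[OF that]], of r v] by simp
    have k': "((\<lambda>s. g (z + s *\<^sub>R v)) has_derivative (\<lambda>r. r * g' (z + s *\<^sub>R v) v)) (at s within {0..t})"
      if "0 \<le> s" "s \<le> t" for s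
      using has_derivative_compose[OF line[of s] g'[OF inW[OF that]]] lin[OF inW[OF that]]
      by (auto intro: has_derivative_at_withinI)
    obtain \<xi> where xi: "0 < \<xi>" "\<xi> < t" "g (z + t *\<^sub>R v) - g (z + 0 *\<^sub>R v) = (t - 0) * g' (z + \<xi> *\<^sub>R v) v"
      using mvt_simple[OF t(1) k'] by auto
    have "t * g' (z + \<xi> *\<^sub>R v) v < 0"
      using d1(2)[of \<xi>] xi t td1 by (simp add: mult_pos_neg)
    then have "g (z + t *\<^sub>R v) < g z" using xi(3) by simp
    then show False using min[OF inW[of t]] t by simp
  qed
qed

text \<open>Completing the square avoids diagonalisation: \<open>p\<close> times the last expression
  is the Hessian in direction \<open>(p, q)\<close> plus \<open>p * r - q\<^sup>2\<close> times the
  Hessian in direction \<open>(0, 1)\<close>.\<close>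

lemma elliptic_nonneg_at_min:
  assumes jet: "has_jet2_on g g1 g2 g11 g12 g22 W" and W: "open W" "z \<in> W"
    and min: "\<And>y. y \<in> W \<Longrightarrow> g z \<le> g y"
    and ell: "p > 0" "p * r - q\<^sup>2 > (0::real)"
  shows "g1 z = 0" "g2 z = 0" "0 \<le> p * g11 z + 2 * q * g12 z + r * g22 z"
proof -
  define g' where "g' y h = h$1 * g1 y + h$2 * g2 y" for y and h :: "real^2"
  have g': "\<And>y. y \<in> W \<Longrightarrow> (g has_derivative g' y) (at y)"
    using jet unfolding has_jet2_on_real_iff g'_def by blast
  have L: "((\<lambda>y. g' y v) has_derivative
      (\<lambda>h. v$1 * (h$1 * g11 z + h$2 * g12 z) + v$2 * (h$1 * g12 z + h$2 * g22 z))) (at z)" for v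
    using jet W(2) unfolding has_jet2_on_real_iff g'_def by (auto intro!: derivative_intros)
  have 0: "h$1 * g1 z + h$2 * g2 z = 0" for h :: "real^2"
    using fun_cong[OF second_derivative_nonneg_at_min(1)[OF W _ g' L], of h] min
    unfolding g'_def by blast
  show "g1 z = 0" using 0[of "axis 1 1"] by (simp add: axis_def)
  show "g2 z = 0" using 0[of "axis 2 1"] by (simp add: axis_def)
  have Q: "0 \<le> s\<^sup>2 * g11 z + 2 * s * t * g12 z + t\<^sup>2 * g22 z" for s t
    using second_derivative_nonneg_at_min(2)[OF W _ g' L[of "vector [s, t]"]] min
    by (simp add: power2_eq_square algebra_simps)
  have "0 \<le> p\<^sup>2 * g11 z + 2 * p * q * g12 z + q\<^sup>2 * g22 z" by (rule Q)
  moreover have "0 \<le> (p * r - q\<^sup>2) * g22 z" using Q[of 0 1] ell by simp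
  ultimately have "0 \<le> p * (p * g11 z + 2 * q * g12 z + r * g22 z)"
    by (simp add: power2_eq_square algebra_simps)
  then show "0 \<le> p * g11 z + 2 * q * g12 z + r * g22 z"
    using ell by (simp add: zero_le_mult_iff)
qed

lemma dist_real2_squared: "(dist x y)\<^sup>2 = (x$1 - y$1)\<^sup>2 + (x$2 - y$2)\<^sup>2" for x y :: "real^2"
  by (simp only: dist_norm power2_norm_eq_inner inner_vec_def sum_2) (simp add: power2_eq_square)

lemma has_derivative_nth [derivative_intros]:
  "((\<lambda>x. x $ i) has_derivative (\<lambda>h. h $ i)) (at x within S)"
  by (rule bounded_linear_imp_has_derivative) (rule bounded_linear_vec_nth)

lemma gaussian_has_jet2_on:
  fixes y :: "real^2" and \<alpha> \<beta> :: real
  defines "E \<equiv> \<lambda>x. exp (- \<alpha> * ((x$1 - y$1)\<^sup>2 + (x$2 - y$2)\<^sup>2))"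
  shows "has_jet2_on (\<lambda>x. E x - \<beta>)
     (\<lambda>x. - 2 * \<alpha> * (x$1 - y$1) * E x) (\<lambda>x. - 2 * \<alpha> * (x$2 - y$2) * E x)
     (\<lambda>x. (4 * \<alpha>\<^sup>2 * (x$1 - y$1)\<^sup>2 - 2 * \<alpha>) * E x)
     (\<lambda>x. 4 * \<alpha>\<^sup>2 * (x$1 - y$1) * (x$2 - y$2) * E x)
     (\<lambda>x. (4 * \<alpha>\<^sup>2 * (x$2 - y$2)\<^sup>2 - 2 * \<alpha>) * E x) D"
proof -
  have E: "(E has_derivative (\<lambda>h. h$1 * (- 2 * \<alpha> * (x$1 - y$1) * E x) + h$2 * (- 2 * \<alpha> * (x$2 - y$2) * E x))) (at x)" for x
    unfolding E_def
    by (rule derivative_eq_intros has_derivative_nth refl | rule ext)+ (simp add: algebra_simps)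
  show ?thesis
    unfolding has_jet2_on_real_iff
    apply (intro ballI conjI)
      apply (rule derivative_eq_intros E refl | rule ext)+ 
      apply (simp add: algebra_simps)
     apply (rule derivative_eq_intros has_derivative_nth E refl | rule ext)+ 
     apply (simp add: algebra_simps power2_eq_square)
    apply (rule derivative_eq_intros has_derivative_nth E refl | rule ext)+ 
    apply (simp add: algebra_simps power2_eq_square)
    done
qed

lemma has_jet2_on_diff_scaled:
  fixes u w :: "real^2 \<Rightarrow> real"
  assumes "has_jet2_on u u1 u2 u11 u12 u22 D" "has_jet2_on w w1 w2 w11 w12 w22 D"
  shows "has_jet2_on (\<lambda>x. u x - e * w x) (\<lambda>x. u1 x - e * w1 x) (\<lambda>x. u2 x - e * w2 x)
    (\<lambda>x. u11 x - e * w11 x) (\<lambda>x. u12 x - e * w12 x) (\<lambda>x. u22 x - e * w22 x) D"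
  using has_partials_diff[OF has_jet2_onD(1)[OF assms(1)] has_partials_scaleR[OF has_jet2_onD(1)[OF assms(2)]]]
    has_partials_diff[OF has_jet2_onD(2)[OF assms(1)] has_partials_scaleR[OF has_jet2_onD(2)[OF assms(2)]]]
    has_partials_diff[OF has_jet2_onD(3)[OF assms(1)] has_partials_scaleR[OF has_jet2_onD(3)[OF assms(2)]]]
  unfolding has_jet2_on_def by simp

section \<open>Hopf's argument and the strong maximum principle\<close>

text \<open>Ellipticity is only pointwise and \<open>c\<close> has no sign; uniform bounds are
  obtained from continuity on a compact annulus.\<close>

locale elliptic_operator =
  fixes D :: "(real^2) set" and a11 a12 a22 b1 b2 c :: "real^2 \<Rightarrow> real"
  assumes open_D: "open D"
    and cont: "continuous_on D a11" "continuous_on D a12" "continuous_on D a22"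
      "continuous_on D b1" "continuous_on D b2" "continuous_on D c"
    and elliptic: "\<And>x. x \<in> D \<Longrightarrow> a11 x > 0" "\<And>x. x \<in> D \<Longrightarrow> a11 x * a22 x - (a12 x)\<^sup>2 > 0"
begin

lemma quadratic_form_pos:
  assumes "x \<in> D" "s \<noteq> 0 \<or> t \<noteq> 0"
  shows "a11 x * s\<^sup>2 + 2 * a12 x * s * t + a22 x * t\<^sup>2 > 0"
proof -
  have "a11 x * (a11 x * s\<^sup>2 + 2 * a12 x * s * t + a22 x * t\<^sup>2)
      = (a11 x * s + a12 x * t)\<^sup>2 + (a11 x * a22 x - (a12 x)\<^sup>2) * t\<^sup>2"
    by (simp add: power2_eq_square algebra_simps)
  also have "\<dots> > 0"
  proof (cases "t = 0")
    case True
    then show ?thesis using assms elliptic(1)[of x] by simp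
  next
    case False
    then show ?thesis using elliptic(2)[of x] assms by (simp add: add_nonneg_pos)
  qed
  finally show ?thesis using elliptic(1)[of x] assms by (simp add: zero_less_mult_iff)
qed

text \<open>Hopf's boundary point argument: on the annulus between the spheres of radius \<open>R/2\<close> and \<open>R\<close>
  the solution dominates a multiple of a Gaussian barrier, which has a nonzero normal derivative.\<close>

lemma hopf_touching:
  assumes jet: "has_jet2_on u u1 u2 u11 u12 u22 D"
    and super: "\<And>x. x \<in> D \<Longrightarrow>
      a11 x * u11 x + 2 * a12 x * u12 x + a22 x * u22 x + b1 x * u1 x + b2 x * u2 x + c x * u x \<le> 0"
    and nonneg: "\<And>x. x \<in> D \<Longrightarrow> u x \<ge> 0"
    and R: "R > 0" "cball y R \<subseteq> D" and pos: "\<And>z. z \<in> ball y R \<Longrightarrow> u z > 0"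
    and x0: "dist y x0 = R" "u x0 = 0"
  shows False
proof -
  \<comment> \<open>The centre has to be cut out: \<open>q\<close> vanishes at \<open>y\<close>, so
    the Gaussian would not be a strict subsolution there.\<close>
  define K where "K = cball y R - ball y (R/2)"
  have K: "compact K" unfolding K_def by (simp add: compact_diff)
  have KD: "K \<subseteq> D" using R unfolding K_def by auto
  have x0K: "x0 \<in> K" and x0D: "x0 \<in> D" using x0 R unfolding K_def by auto
  have cK: "continuous_on K a11" "continuous_on K a12" "continuous_on K a22"
      "continuous_on K b1" "continuous_on K b2" "continuous_on K c"
    using cont KD continuous_on_subset by blast+
  define q where "q x = a11 x * (x$1 - y$1)\<^sup>2 + 2 * a12 x * (x$1 - y$1) * (x$2 - y$2)
    + a22 x * (x$2 - y$2)\<^sup>2" for x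
  have "continuous_on K q" unfolding q_def by (intro continuous_intros cK)
  then obtain xm where xm: "xm \<in> K" "\<And>x. x \<in> K \<Longrightarrow> q xm \<le> q x"
    using continuous_attains_inf[OF K] x0K by blast
  define m where "m = q xm"
  have m: "m > 0"
  proof -
    have "y \<noteq> xm" using xm(1) R unfolding K_def by auto
    then have "xm$1 - y$1 \<noteq> 0 \<or> xm$2 - y$2 \<noteq> 0" by (auto simp: vec_eq_iff forall_2)
    then show ?thesis unfolding m_def q_def using quadratic_form_pos[of xm] xm(1) KD by blast
  qed
  define \<tau> where "\<tau> x = a11 x + a22 x + b1 x * (x$1 - y$1) + b2 x * (x$2 - y$2)" for x
  have "continuous_on K (\<lambda>x. \<bar>\<tau> x\<bar>)" unfolding \<tau>_def by (intro continuous_intros cK)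
  then obtain xt where xt: "xt \<in> K" "\<And>x. x \<in> K \<Longrightarrow> \<bar>\<tau> x\<bar> \<le> \<bar>\<tau> xt\<bar>"
    using continuous_attains_sup[OF K] x0K by blast
  define T where "T = \<bar>\<tau> xt\<bar>"
  have "continuous_on K (\<lambda>x. \<bar>c x\<bar>)" by (intro continuous_intros cK)
  then obtain xc where xc: "xc \<in> K" "\<And>x. x \<in> K \<Longrightarrow> \<bar>c x\<bar> \<le> \<bar>c xc\<bar>"
    using continuous_attains_sup[OF K] x0K by blast
  define C where "C = \<bar>c xc\<bar>"
  have T: "T \<ge> 0" and C: "C \<ge> 0" by (simp_all add: T_def C_def)
  \<comment> \<open>The operator without its zeroth order term, applied to the barrier, gives
    \<open>E\<close> times \<open>4 * \<alpha>\<^sup>2 * q - 2 * \<alpha> * \<tau>\<close>. The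
    quotient makes \<open>4 * \<alpha> * m\<close> at least \<open>2 * T + C + 1\<close>, and
    \<alpha> \<ge> 1 turns the remaining \<open>\<alpha> * (C + 1)\<close> into more than
    \<open>C\<close>.\<close>
  define \<alpha> where "\<alpha> = max 1 ((2 * T + C + 1) / (4 * m))"
  have \<alpha>: "\<alpha> \<ge> 1" by (simp add: \<alpha>_def)
  have \<alpha>m: "4 * \<alpha>\<^sup>2 * m - 2 * \<alpha> * T > C"
  proof -
    have "(2 * T + C + 1) / (4 * m) \<le> \<alpha>" unfolding \<alpha>_def by (rule max.cobounded2)
    then have "2 * T + C + 1 \<le> \<alpha> * (4 * m)" using m by (simp add: field_simps)
    then have "\<alpha> * (2 * T + C + 1) \<le> \<alpha> * (\<alpha> * (4 * m))" using \<alpha> by (intro mult_left_mono) auto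
    moreover have "1 * (C + 1) \<le> \<alpha> * (C + 1)" using \<alpha> C by (intro mult_right_mono) auto
    ultimately show ?thesis by (simp add: power2_eq_square algebra_simps)
  qed
  define E where "E x = exp (- \<alpha> * ((x$1 - y$1)\<^sup>2 + (x$2 - y$2)\<^sup>2))" for x :: "real^2"
  have E: "E x > 0" for x by (simp add: E_def)
  have E_dist: "E x = exp (- \<alpha> * (dist y x)\<^sup>2)" for x
    unfolding E_def dist_commute[of y] dist_real2_squared ..
  \<comment> \<open>Makes the barrier vanish on the outer sphere, which contains
    \<open>x0\<close>.\<close>
  define \<beta> where "\<beta> = exp (- \<alpha> * R\<^sup>2)"
  define w where "w x = E x - \<beta>" for x
  define w1 where "w1 x = - 2 * \<alpha> * (x$1 - y$1) * E x" for x
  define w2 where "w2 x = - 2 * \<alpha> * (x$2 - y$2) * E x" for x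
  define w11 where "w11 x = (4 * \<alpha>\<^sup>2 * (x$1 - y$1)\<^sup>2 - 2 * \<alpha>) * E x" for x
  define w12 where "w12 x = 4 * \<alpha>\<^sup>2 * (x$1 - y$1) * (x$2 - y$2) * E x" for x
  define w22 where "w22 x = (4 * \<alpha>\<^sup>2 * (x$2 - y$2)\<^sup>2 - 2 * \<alpha>) * E x" for x
  have jw: "has_jet2_on w w1 w2 w11 w12 w22 D"
    using gaussian_has_jet2_on[of \<alpha> y \<beta> D]
    unfolding w_def[abs_def] w1_def[abs_def] w2_def[abs_def] w11_def[abs_def] w12_def[abs_def]
      w22_def[abs_def] E_def[abs_def] by simp
  have "compact (sphere y (R/2))" "sphere y (R/2) \<subseteq> D" "sphere y (R/2) \<noteq> {}"
    using R by auto
  then obtain xs where xs: "xs \<in> sphere y (R/2)" "\<And>x. x \<in> sphere y (R/2) \<Longrightarrow> u xs \<le> u x"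
    using continuous_attains_inf[of "sphere y (R/2)" u] has_jet2_on_continuous(1)[OF jet]
      continuous_on_subset by blast
  \<comment> \<open>Since \<open>w\<close> is at most 1, \<open>\<epsilon> * w\<close> lies below
    \<open>u\<close> on the inner sphere.\<close>
  define \<epsilon> where "\<epsilon> = u xs"
  have \<epsilon>: "\<epsilon> > 0" using pos[of xs] xs(1) R unfolding \<epsilon>_def by auto
  define g where "g x = u x - \<epsilon> * w x" for x
  define g1 where "g1 x = u1 x - \<epsilon> * w1 x" for x
  define g2 where "g2 x = u2 x - \<epsilon> * w2 x" for x
  have jg: "has_jet2_on g g1 g2 (\<lambda>x. u11 x - \<epsilon> * w11 x) (\<lambda>x. u12 x - \<epsilon> * w12 x)
      (\<lambda>x. u22 x - \<epsilon> * w22 x) D"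
    using has_jet2_on_diff_scaled[OF jet jw] unfolding g_def[abs_def] g1_def[abs_def] g2_def[abs_def] .
  have "continuous_on K g" using has_jet2_on_continuous(1)[OF jg] KD continuous_on_subset by blast
  then obtain z where z: "z \<in> K" "\<And>x. x \<in> K \<Longrightarrow> g z \<le> g x"
    using continuous_attains_inf[OF K] x0K by blast
  \<comment> \<open>Comparison on the annulus: a negative minimum of \<open>g\<close> can lie on
    neither sphere, and in between the first and second order conditions contradict the choice of
    \<alpha>.\<close>
  have gz: "g z \<ge> 0"
  proof (rule ccontr)
    assume "\<not> g z \<ge> 0"
    then have neg: "g z < 0" by simp
    have zD: "z \<in> D" using z KD by blast
    have "dist y z \<noteq> R"
    proof
      assume "dist y z = R"
      then have "w z = 0" unfolding w_def E_dist \<beta>_def by simp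
      then show False using neg nonneg[OF zD] by (simp add: g_def)
    qed
    moreover have "dist y z \<noteq> R/2"
    proof
      assume d: "dist y z = R/2"
      have "w z \<le> 1"
      proof -
        have "E z \<le> 1" unfolding E_dist using \<alpha> by simp
        moreover have "\<beta> > 0" by (simp add: \<beta>_def)
        ultimately show ?thesis by (simp add: w_def)
      qed
      then have "\<epsilon> * w z \<le> \<epsilon>" using \<epsilon> by simp
      moreover have "u z \<ge> \<epsilon>" using xs(2)[of z] d unfolding \<epsilon>_def by simp
      ultimately show False using neg by (simp add: g_def)
    qed
    ultimately have zW: "z \<in> ball y R - cball y (R/2)" using z(1) unfolding K_def by auto
    have WK: "ball y R - cball y (R/2) \<subseteq> K" unfolding K_def by auto
    have W: "open (ball y R - cball y (R/2))" by (simp add: open_Diff)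
    have zmin: "g z \<le> g x" if "x \<in> ball y R - cball y (R/2)" for x
      using that WK z(2) by blast
    note min = has_jet2_on_subset[OF jg order_trans[OF WK KD]] W zW zmin elliptic[OF zD]
    have g12: "g1 z = 0" "g2 z = 0"
      and hess: "0 \<le> a11 z * (u11 z - \<epsilon> * w11 z) + 2 * a12 z * (u12 z - \<epsilon> * w12 z)
        + a22 z * (u22 z - \<epsilon> * w22 z)"
      by (rule elliptic_nonneg_at_min[OF min]; assumption)+
    define Lw where "Lw = a11 z * w11 z + 2 * a12 z * w12 z + a22 z * w22 z + b1 z * w1 z + b2 z * w2 z"
    have "u1 z = \<epsilon> * w1 z" "u2 z = \<epsilon> * w2 z" using g12 by (simp_all add: g1_def g2_def)
    then have "\<epsilon> * Lw \<le> - c z * u z"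
      using hess super[OF zD] unfolding Lw_def by (simp add: algebra_simps)
    also have "\<dots> \<le> C * u z"
      using xc(2)[OF z(1)] nonneg[OF zD] unfolding C_def by (intro mult_right_mono) auto
    also have "\<dots> \<le> C * (\<epsilon> * E z)"
    \<comment> \<open>The negativity of \<open>g z\<close> puts \<open>u z\<close> below
      \<open>\<epsilon> * w z\<close>; this is how the zeroth order term is absorbed whatever the
      sign of \<open>c\<close>.\<close>
    proof (rule mult_left_mono[OF _ C])
      have "u z \<le> \<epsilon> * w z" using neg by (simp add: g_def)
      also have "\<dots> \<le> \<epsilon> * E z" using \<epsilon> by (simp add: w_def \<beta>_def)
      finally show "u z \<le> \<epsilon> * E z" .
    qed
    finally have "\<epsilon> * Lw \<le> \<epsilon> * (C * E z)" by (simp add: algebra_simps)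
    then have le: "Lw \<le> C * E z" using \<epsilon> by simp
    have "Lw = E z * (4 * \<alpha>\<^sup>2 * q z - 2 * \<alpha> * \<tau> z)"
      unfolding Lw_def w11_def w12_def w22_def w1_def w2_def q_def \<tau>_def
      by (simp add: algebra_simps power2_eq_square)
    moreover have "4 * \<alpha>\<^sup>2 * q z - 2 * \<alpha> * \<tau> z > C"
    proof -
      have "4 * \<alpha>\<^sup>2 * m \<le> 4 * \<alpha>\<^sup>2 * q z" using xm(2)[OF z(1)] unfolding m_def by (intro mult_left_mono) auto
      moreover have "2 * \<alpha> * \<tau> z \<le> 2 * \<alpha> * T"
        using xt(2)[OF z(1)] \<alpha> unfolding T_def by (intro mult_left_mono) auto
      ultimately show ?thesis using \<alpha>m by linarith
    qed
    ultimately have "C * E z < Lw" using E[of z] by (simp add: mult.commute)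
    then show False using le by simp
  qed
  \<comment> \<open>\<open>x0\<close> is a minimum of \<open>u\<close> in the open set
    \<open>D\<close>, so \<open>u\<close> has zero gradient there. The slope of \<open>g\<close>
    towards \<open>y\<close> is then that of \<open>- \<epsilon> * w\<close>, which is negative
    because the Gaussian grows towards its centre; so \<open>g\<close> would be negative inside the
    annulus.\<close>
  have x0min: "u x0 \<le> u x" if "x \<in> D" for x using nonneg[OF that] x0(2) by simp
  have u0: "u1 x0 = 0" "u2 x0 = 0"
    by (rule elliptic_nonneg_at_min[OF jet open_D x0D x0min elliptic[OF x0D]]; assumption)+
  have gx0: "g x0 = 0" using x0 unfolding g_def w_def E_dist \<beta>_def by simp
  define k where "k t = g (x0 + t *\<^sub>R (y - x0))" for t
  define \<delta> where "\<delta> = (y - x0)$1 * g1 x0 + (y - x0)$2 * g2 x0"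
  have "(g has_derivative (\<lambda>h. h$1 * g1 x0 + h$2 * g2 x0)) (at (x0 + 0 *\<^sub>R (y - x0)))"
    using jg x0D unfolding has_jet2_on_real_iff by simp
  moreover have "((\<lambda>t. x0 + t *\<^sub>R (y - x0)) has_derivative (\<lambda>r. r *\<^sub>R (y - x0))) (at 0)"
    by (auto intro!: derivative_eq_intros)
  ultimately have "((\<lambda>t. g (x0 + t *\<^sub>R (y - x0))) has_derivative
      (\<lambda>r. (r *\<^sub>R (y - x0))$1 * g1 x0 + (r *\<^sub>R (y - x0))$2 * g2 x0)) (at 0)"
    by (rule has_derivative_compose[rotated])
  moreover have "(r *\<^sub>R (y - x0))$1 * g1 x0 + (r *\<^sub>R (y - x0))$2 * g2 x0 = r * \<delta>" for r
    unfolding \<delta>_def by (simp add: distrib_left)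
  ultimately have "(k has_derivative (\<lambda>r. r * \<delta>)) (at 0)"
    unfolding k_def[abs_def] by simp
  then have k': "(k has_real_derivative \<delta>) (at 0)"
    by (simp add: has_field_derivative_def mult_commute_abs)
  have "\<delta> = - 2 * \<alpha> * \<epsilon> * E x0 * R\<^sup>2"
    unfolding \<delta>_def g1_def g2_def u0 w1_def w2_def x0(1)[symmetric] dist_real2_squared
    by (simp add: power2_eq_square) algebra
  then have "\<delta> < 0" using \<alpha> \<epsilon> E[of x0] R by simp
  from DERIV_neg_dec_right[OF k' this] obtain d where d: "d > 0" "\<And>h. 0 < h \<Longrightarrow> h < d \<Longrightarrow> k h < k 0"
    by auto
  \<comment> \<open>The bound 1/2 keeps the point outside the inner ball.\<close>
  define h where "h = min (d/2) (1/2)"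
  have h: "0 < h" "h < d" "h \<le> 1/2" using d(1) by (auto simp: h_def min_def)
  have "dist y (x0 + h *\<^sub>R (y - x0)) = (1 - h) * R"
  proof -
    have "y - (x0 + h *\<^sub>R (y - x0)) = (1 - h) *\<^sub>R (y - x0)" by (simp add: algebra_simps)
    then show ?thesis using h x0(1) by (simp add: dist_norm)
  qed
  moreover have "R/2 \<le> (1 - h) * R" "(1 - h) * R \<le> R"
    using h R by (auto simp: field_simps)
  ultimately have "x0 + h *\<^sub>R (y - x0) \<in> K" unfolding K_def by auto
  then have "k h \<ge> 0" using z(2) gz unfolding k_def by force
  then show False using d(2)[OF h(1,2)] gx0 by (simp add: k_def)
qed

text \<open>The zero set is closed in \<open>D\<close>; if it were not open, a nearby point with
  positive value would have a largest zero-free ball, and \<open>hopf_touching\<close> rules out the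
  zero on its sphere.\<close>

lemma strong_maximum_principle:
  assumes jet: "has_jet2_on u u1 u2 u11 u12 u22 D"
    and super: "\<And>x. x \<in> D \<Longrightarrow>
      a11 x * u11 x + 2 * a12 x * u12 x + a22 x * u22 x + b1 x * u1 x + b2 x * u2 x + c x * u x \<le> 0"
    and nonneg: "\<And>x. x \<in> D \<Longrightarrow> u x \<ge> 0"
    and D: "connected D" and p: "p \<in> D" "u p = 0" and x: "x \<in> D"
  shows "u x = 0"
proof -
  define Z where "Z = {x \<in> D. u x = 0}"
  have cont_u: "continuous_on D u" using has_jet2_on_continuous(1)[OF jet] .
  have Zc: "closedin (top_of_set D) Z"
    unfolding Z_def using continuous_closedin_preimage_constant[OF cont_u] by simp
  have "open Z"
  proof (rule openI)
    fix p assume "p \<in> Z"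
    then have p: "p \<in> D" "u p = 0" by (auto simp: Z_def)
    obtain r where r: "r > 0" "cball p r \<subseteq> D" using open_D p open_contains_cball by blast
    \<comment> \<open>Half the radius, so that the ball around \<open>y\<close> reaching as far as
      \<open>p\<close> still lies in \<open>cball p r\<close>.\<close>
    have "ball p (r/2) \<subseteq> Z"
    proof
      fix y assume y: "y \<in> ball p (r/2)"
      have sub: "cball y (dist y p) \<subseteq> D"
      proof
        fix z assume "z \<in> cball y (dist y p)"
        then have "dist p z \<le> r" using y dist_triangle[of p z y] by (simp add: dist_commute)
        then show "z \<in> D" using r by auto
      qed
      then have yD: "y \<in> D" by auto
      show "y \<in> Z"
      proof (rule ccontr)
        assume "y \<notin> Z"
        then have uy: "u y \<noteq> 0" using yD by (simp add: Z_def)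
        define B where "B = {z \<in> cball y (dist y p). u z = 0}"
        have "closedin (top_of_set (cball y (dist y p))) B"
          unfolding B_def using continuous_closedin_preimage_constant[OF continuous_on_subset[OF cont_u sub]] by simp
        then have "compact B" by (rule closedin_compact[OF compact_cball])
        moreover have "p \<in> B" using p by (simp add: B_def)
        moreover have "continuous_on B (dist y)" by (intro continuous_intros)
        ultimately obtain x0 where x0: "x0 \<in> B" "\<And>z. z \<in> B \<Longrightarrow> dist y x0 \<le> dist y z"
          using continuous_attains_inf[of B "dist y"] by blast
        have "dist y x0 \<noteq> 0" using x0(1) uy by (auto simp: B_def)
        then have R: "dist y x0 > 0" by simp
        have Rle: "dist y x0 \<le> dist y p" using x0(1) by (simp add: B_def)
        have "u z > 0" if "z \<in> ball y (dist y x0)" for z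
        proof -
          have "z \<in> D" "z \<notin> B" using that x0(2)[of z] Rle sub by auto
          then show ?thesis using nonneg[of z] that Rle by (auto simp: B_def)
        qed
        moreover have "cball y (dist y x0) \<subseteq> D" using Rle sub by auto
        ultimately show False
          using hopf_touching[OF jet super nonneg R _ _ refl] x0(1) by (auto simp: B_def)
      qed
    qed
    then show "\<exists>e>0. ball p e \<subseteq> Z" using r by (intro exI[of _ "r/2"]) auto
  qed
  then have "openin (top_of_set D) Z" unfolding Z_def by (intro openin_open_eq[THEN iffD2] open_D) auto
  then have "Z = {} \<or> Z = D" using D Zc unfolding connected_clopen by blast
  then have "Z = D" using p by (auto simp: Z_def)
  then show ?thesis using x by (auto simp: Z_def)
qed

end

section \<open>The elliptic equation for the angle function\<close>

unbundle cross3_syntax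

section \<open>Linear algebra of a tangent frame with its normal\<close>

text \<open>Both \<open>d\<close> and \<open>n\<close> are orthogonal to \<open>x1\<close> and
  \<open>x2\<close>, hence parallel to the nonzero vector \<open>x1 \<times> x2\<close>; so
  \<open>d\<close> is a multiple of \<open>n\<close>, and it is also orthogonal to
  \<open>n\<close>.\<close>

lemma orthogonal_frame_imp_zero:
  fixes n x1 x2 d :: "real^3"
  assumes n: "n \<noteq> 0" "n \<bullet> x1 = 0" "n \<bullet> x2 = 0"
    and det: "(x1 \<bullet> x1) * (x2 \<bullet> x2) - (x1 \<bullet> x2)\<^sup>2 \<noteq> 0"
    and d: "d \<bullet> n = 0" "d \<bullet> x1 = 0" "d \<bullet> x2 = 0"
  shows "d = 0"
proof -
  define c where "c = x1 \<times> x2"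
  have cc: "c \<bullet> c \<noteq> 0"
    using det unfolding c_def by (simp add: dot_cross power2_eq_square inner_commute)
  have dc: "d \<times> c = 0" and nc: "n \<times> c = 0"
    unfolding c_def Lagrange using d n by simp_all
  have "c \<times> (n \<times> c) = (c \<bullet> c) *\<^sub>R n - (c \<bullet> n) *\<^sub>R c" by (rule Lagrange)
  then have "c \<bullet> n \<noteq> 0" using nc n(1) cc by auto
  moreover have "n \<times> (d \<times> c) = (n \<bullet> c) *\<^sub>R d - (n \<bullet> d) *\<^sub>R c" by (rule Lagrange)
  ultimately show ?thesis using dc d(1) by (simp add: inner_commute)
qed

text \<open>Cramer's rule with the Gram determinant cleared, so that later identities stay
  polynomial.\<close>

lemma frame_expansion:
  fixes n x1 x2 w :: "real^3"
  assumes n: "n \<bullet> n = 1" "n \<bullet> x1 = 0" "n \<bullet> x2 = 0"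
    and det: "(x1 \<bullet> x1) * (x2 \<bullet> x2) - (x1 \<bullet> x2)\<^sup>2 = \<Delta>" "\<Delta> \<noteq> 0"
  shows "\<Delta> *\<^sub>R w = (\<Delta> * (w \<bullet> n)) *\<^sub>R n
    + ((x2 \<bullet> x2) * (w \<bullet> x1) - (x1 \<bullet> x2) * (w \<bullet> x2)) *\<^sub>R x1
    + ((x1 \<bullet> x1) * (w \<bullet> x2) - (x1 \<bullet> x2) * (w \<bullet> x1)) *\<^sub>R x2" (is "_ = ?r")
proof -
  have comm: "x1 \<bullet> n = 0" "x2 \<bullet> n = 0" "x2 \<bullet> x1 = x1 \<bullet> x2" using n by (simp_all add: inner_commute)
  have "\<Delta> *\<^sub>R w - ?r = 0"
  proof (rule orthogonal_frame_imp_zero[of n x1 x2])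
    show "n \<noteq> 0" using n by auto
    show "(x1 \<bullet> x1) * (x2 \<bullet> x2) - (x1 \<bullet> x2)\<^sup>2 \<noteq> 0" using det by simp
    show "(\<Delta> *\<^sub>R w - ?r) \<bullet> n = 0"
      using n comm by (simp add: inner_simps)
    show "(\<Delta> *\<^sub>R w - ?r) \<bullet> x1 = 0" "(\<Delta> *\<^sub>R w - ?r) \<bullet> x2 = 0"
      unfolding det(1)[symmetric]
      using n comm by (simp_all add: inner_simps power2_eq_square algebra_simps)
  qed fact+
  then show ?thesis by simp
qed

lemma frame_expansion_inner:
  fixes n x1 x2 v w :: "real^3"
  assumes n: "n \<bullet> n = 1" "n \<bullet> x1 = 0" "n \<bullet> x2 = 0"
    and det: "(x1 \<bullet> x1) * (x2 \<bullet> x2) - (x1 \<bullet> x2)\<^sup>2 = \<Delta>" "\<Delta> \<noteq> 0"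
  shows "\<Delta> * (v \<bullet> w) = \<Delta> * (v \<bullet> n) * (w \<bullet> n)
    + ((x2 \<bullet> x2) * (v \<bullet> x1) - (x1 \<bullet> x2) * (v \<bullet> x2)) * (w \<bullet> x1)
    + ((x1 \<bullet> x1) * (v \<bullet> x2) - (x1 \<bullet> x2) * (v \<bullet> x1)) * (w \<bullet> x2)"
proof -
  have "\<Delta> * (v \<bullet> w) = (\<Delta> *\<^sub>R v) \<bullet> w" by simp
  also have "\<dots> = \<Delta> * (v \<bullet> n) * (w \<bullet> n)
    + ((x2 \<bullet> x2) * (v \<bullet> x1) - (x1 \<bullet> x2) * (v \<bullet> x2)) * (w \<bullet> x1)
    + ((x1 \<bullet> x1) * (v \<bullet> x2) - (x1 \<bullet> x2) * (v \<bullet> x1)) * (w \<bullet> x2)"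
    unfolding frame_expansion[OF assms] by (simp add: inner_simps inner_commute)
  finally show ?thesis .
qed

text \<open>The Codazzi equation, traced with the adjugate of the Gram matrix and combined with the
  derivative of the equation \<open>G p11 - 2 F p12 + E p22 = - \<Delta> f\<close> along the first coordinate. The
  second coordinate is the same lemma with the indices exchanged.\<close>

lemma traced_codazzi:
  fixes n x1 x2 :: "real^3"
  assumes n: "n \<bullet> n = 1" "n \<bullet> x1 = 0" "n \<bullet> x2 = 0" "n1 \<bullet> n = 0" "n2 \<bullet> n = 0"
    and EFG: "x1 \<bullet> x1 = E" "x1 \<bullet> x2 = F" "x2 \<bullet> x2 = G" "E * G - F\<^sup>2 = \<Delta>" "\<Delta> \<noteq> 0"
    and p: "x1 \<bullet> n1 = p11" "x1 \<bullet> n2 = p12" "x2 \<bullet> n1 = p12" "x2 \<bullet> n2 = p22"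
    and codazzi: "x11 \<bullet> n2 + x1 \<bullet> n12 = x12 \<bullet> n1 + x2 \<bullet> n11"
      "x12 \<bullet> n2 + x1 \<bullet> n22 = x22 \<bullet> n1 + x2 \<bullet> n12"
    and H: "G * p11 - 2 * F * p12 + E * p22 = - \<Delta> * f"
    and dH: "2 * (x12 \<bullet> x2) * p11 + G * (x11 \<bullet> n1 + x1 \<bullet> n11)
      - 2 * (x11 \<bullet> x2 + x1 \<bullet> x12) * p12 - 2 * F * (x11 \<bullet> n2 + x1 \<bullet> n12)
      + 2 * (x11 \<bullet> x1) * p22 + E * (x12 \<bullet> n2 + x2 \<bullet> n12)
      = - (2 * (x11 \<bullet> x1) * G + E * (2 * (x12 \<bullet> x2)) - 2 * F * (x11 \<bullet> x2 + x1 \<bullet> x12)) * f - \<Delta> * f1"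
  shows "G * (x1 \<bullet> n11) - 2 * F * (x1 \<bullet> n12) + E * (x1 \<bullet> n22)
    = - \<Delta> * f1 + (G *\<^sub>R x11 - (2 * F) *\<^sub>R x12 + E *\<^sub>R x22) \<bullet> n1"
proof -
  have p': "n1 \<bullet> x1 = p11" "n2 \<bullet> x1 = p12" "n1 \<bullet> x2 = p12" "n2 \<bullet> x2 = p22"
    using p by (simp_all add: inner_commute)
  have r: "\<Delta> * (v \<bullet> n1) = (G * (v \<bullet> x1) - F * (v \<bullet> x2)) * p11 + (E * (v \<bullet> x2) - F * (v \<bullet> x1)) * p12"
    "\<Delta> * (v \<bullet> n2) = (G * (v \<bullet> x1) - F * (v \<bullet> x2)) * p12 + (E * (v \<bullet> x2) - F * (v \<bullet> x1)) * p22" for v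
    using frame_expansion_inner[OF n(1-3) _ EFG(5), of v n1]
      frame_expansion_inner[OF n(1-3) _ EFG(5), of v n2] n EFG p'
    by simp_all
  \<comment> \<open>\<open>S\<close> is what separates \<open>dH\<close> from the claim once
    \<open>codazzi\<close> is inserted. It contains no second derivatives of the normal, so it can
    be evaluated by expanding \<open>x11\<close> and \<open>x12\<close> in the frame.\<close>
  define S where "S = 2 * (x12 \<bullet> x2) * p11 - 2 * (x11 \<bullet> x2 + x12 \<bullet> x1) * p12 + 2 * (x11 \<bullet> x1) * p22
    + 2 * G * (x11 \<bullet> n1) - 2 * F * (x11 \<bullet> n2 + x12 \<bullet> n1) + 2 * E * (x12 \<bullet> n2)
    + (2 * (x11 \<bullet> x1) * G + E * (2 * (x12 \<bullet> x2)) - 2 * F * (x11 \<bullet> x2 + x12 \<bullet> x1)) * f"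
  have "\<Delta> * S = \<Delta> * (2 * (x12 \<bullet> x2) * p11 - 2 * (x11 \<bullet> x2 + x12 \<bullet> x1) * p12 + 2 * (x11 \<bullet> x1) * p22)
    + 2 * G * (\<Delta> * (x11 \<bullet> n1)) - 2 * F * (\<Delta> * (x11 \<bullet> n2) + \<Delta> * (x12 \<bullet> n1)) + 2 * E * (\<Delta> * (x12 \<bullet> n2))
    - (2 * (x11 \<bullet> x1) * G + E * (2 * (x12 \<bullet> x2)) - 2 * F * (x11 \<bullet> x2 + x12 \<bullet> x1)) * (- \<Delta> * f)"
    unfolding S_def by (simp add: algebra_simps)
  also have "\<dots> = 0"
    unfolding r H[symmetric] unfolding EFG(4)[symmetric] by (simp add: algebra_simps power2_eq_square)
  finally have "S = 0" using EFG(5) by simp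
  then show ?thesis
    using codazzi dH unfolding S_def by (simp add: inner_simps inner_commute[of x1 x12]) algebra
qed

text \<open>A parametrised surface, with unit normal \<open>n\<close>, whose mean curvature is \<open>p(height) * (n \<bullet> e)\<close>; the
  last assumption is this equation multiplied by the Gram determinant, with the second fundamental
  form written as \<open>X_ij \<bullet> n = - X_i \<bullet> n_j\<close>.\<close>

locale drift_minimal_patch =
  fixes D :: "(real^2) set" and e :: "real^3" and I :: "real set" and p p' :: "real \<Rightarrow> real"
    and X X1 X2 X11 X12 X22 n n1 n2 n11 n12 n22 :: "real^2 \<Rightarrow> real^3"
  assumes open_D: "open D"
    and X_jet: "has_jet2_on X X1 X2 X11 X12 X22 D"
    and X_cont: "continuous_on D X11" "continuous_on D X12" "continuous_on D X22"
    and n_jet: "has_jet2_on n n1 n2 n11 n12 n22 D"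
    and unit: "\<And>x. x \<in> D \<Longrightarrow> n x \<bullet> n x = 1"
    and normal: "\<And>x. x \<in> D \<Longrightarrow> n x \<bullet> X1 x = 0" "\<And>x. x \<in> D \<Longrightarrow> n x \<bullet> X2 x = 0"
    and gram: "\<And>x. x \<in> D \<Longrightarrow> (X1 x \<bullet> X1 x) * (X2 x \<bullet> X2 x) - (X1 x \<bullet> X2 x)\<^sup>2 > 0"
    and height: "\<And>x. x \<in> D \<Longrightarrow> X x \<bullet> e \<in> I"
    and p: "\<And>z. z \<in> I \<Longrightarrow> (p has_real_derivative p' z) (at z)" "continuous_on I p'"
    and mean_curvature_eq: "\<And>x. x \<in> D \<Longrightarrow>
      (X2 x \<bullet> X2 x) * (X1 x \<bullet> n1 x) - 2 * (X1 x \<bullet> X2 x) * (X1 x \<bullet> n2 x) + (X1 x \<bullet> X1 x) * (X2 x \<bullet> n2 x)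
      = - ((X1 x \<bullet> X1 x) * (X2 x \<bullet> X2 x) - (X1 x \<bullet> X2 x)\<^sup>2) * (p (X x \<bullet> e) * (n x \<bullet> e))"
begin

definition "E x = X1 x \<bullet> X1 x"
definition "F x = X1 x \<bullet> X2 x"
definition "G x = X2 x \<bullet> X2 x"
definition "\<Delta> x = E x * G x - (F x)\<^sup>2"
text \<open>\<Delta> times the trace of the coordinate second derivatives of \<open>X\<close>; its
  tangential part carries the traced Christoffel symbols.\<close>

definition "R x = G x *\<^sub>R X11 x - (2 * F x) *\<^sub>R X12 x + E x *\<^sub>R X22 x"
text \<open>\<open>t1\<close> and \<open>t2\<close> are \<Delta> times the components of the
  tangential part of \<open>e\<close>, that is, of the gradient of the height.\<close>

definition "t1 x = G x * (e \<bullet> X1 x) - F x * (e \<bullet> X2 x)"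
definition "t2 x = E x * (e \<bullet> X2 x) - F x * (e \<bullet> X1 x)"
text \<open>\<Delta> times the squared norm of the second fundamental form.\<close>

definition "K x = G x * (n1 x \<bullet> n1 x) - 2 * F x * (n1 x \<bullet> n2 x) + E x * (n2 x \<bullet> n2 x)"

lemmas partials = has_jet2_onD[OF X_jet] has_jet2_onD[OF n_jet]

lemma E_partials: "x \<in> D \<Longrightarrow> has_partials E (2 * (X11 x \<bullet> X1 x)) (2 * (X12 x \<bullet> X1 x)) x"
  using has_partials_inner[OF partials(2) partials(2), of x]
  unfolding E_def[abs_def] by (simp add: inner_commute)

lemma F_partials:
  "x \<in> D \<Longrightarrow> has_partials F (X11 x \<bullet> X2 x + X1 x \<bullet> X12 x) (X12 x \<bullet> X2 x + X1 x \<bullet> X22 x) x"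
  using has_partials_inner[OF partials(2) partials(3), of x] unfolding F_def[abs_def] by simp

lemma G_partials: "x \<in> D \<Longrightarrow> has_partials G (2 * (X12 x \<bullet> X2 x)) (2 * (X22 x \<bullet> X2 x)) x"
  using has_partials_inner[OF partials(3) partials(3), of x]
  unfolding G_def[abs_def] by (simp add: inner_commute)

lemma \<Delta>_pos: "x \<in> D \<Longrightarrow> \<Delta> x > 0"
  using gram by (simp add: \<Delta>_def E_def F_def G_def)

lemma G_pos: "x \<in> D \<Longrightarrow> G x > 0"
proof -
  assume "x \<in> D"
  then have "E x * G x > 0" using \<Delta>_pos[of x] unfolding \<Delta>_def by (smt (verit) zero_le_power2)
  then show "G x > 0" unfolding G_def E_def by (metis inner_ge_zero mult_eq_0_iff order_less_le)
qed

lemma normal_derivs: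
  assumes x: "x \<in> D"
  shows "n1 x \<bullet> n x = 0" "n2 x \<bullet> n x = 0"
proof -
  have "has_partials (\<lambda>x. n x \<bullet> n x) 0 0 x"
    by (rule has_partials_transform[OF has_partials_const open_D x]) (use unit in simp)
  from has_partials_unique[OF this has_partials_inner[OF partials(4) partials(4), OF x x]]
  show "n1 x \<bullet> n x = 0" "n2 x \<bullet> n x = 0" by (simp_all add: inner_commute)
qed

lemma normal_second_derivs:
  assumes x: "x \<in> D"
  shows "n11 x \<bullet> n x = - (n1 x \<bullet> n1 x)" "n12 x \<bullet> n x = - (n1 x \<bullet> n2 x)"
    "n22 x \<bullet> n x = - (n2 x \<bullet> n2 x)"
proof -
  have "has_partials (\<lambda>x. n1 x \<bullet> n x) 0 0 x" "has_partials (\<lambda>x. n2 x \<bullet> n x) 0 0 x"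
    by (rule has_partials_transform[OF has_partials_const open_D x]; use normal_derivs in simp)+
  from has_partials_unique[OF this(1) has_partials_inner[OF partials(5) partials(4), OF x x]]
    has_partials_unique[OF this(2) has_partials_inner[OF partials(6) partials(4), OF x x]]
  show "n11 x \<bullet> n x = - (n1 x \<bullet> n1 x)" "n12 x \<bullet> n x = - (n1 x \<bullet> n2 x)"
    "n22 x \<bullet> n x = - (n2 x \<bullet> n2 x)" by simp_all
qed

lemma sff_symmetric:
  assumes x: "x \<in> D"
  shows "X2 x \<bullet> n1 x = X1 x \<bullet> n2 x"
proof -
  have "has_partials (\<lambda>x. n x \<bullet> X1 x) 0 0 x" "has_partials (\<lambda>x. n x \<bullet> X2 x) 0 0 x"
    by (rule has_partials_transform[OF has_partials_const open_D x]; use normal in simp)+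
  from has_partials_unique(2)[OF this(1) has_partials_inner[OF partials(4) partials(2), OF x x]]
    has_partials_unique(1)[OF this(2) has_partials_inner[OF partials(4) partials(3), OF x x]]
  show ?thesis by (simp add: inner_commute)
qed

text \<open>Obtained by differentiating the identity \<open>sff_symmetric\<close> along both
  coordinates, with the mixed derivatives \<open>X12\<close> and \<open>n12\<close> shared by the
  two sides.\<close>

lemma codazzi:
  assumes x: "x \<in> D"
  shows "X11 x \<bullet> n2 x + X1 x \<bullet> n12 x = X12 x \<bullet> n1 x + X2 x \<bullet> n11 x"
    "X12 x \<bullet> n2 x + X1 x \<bullet> n22 x = X22 x \<bullet> n1 x + X2 x \<bullet> n12 x"
proof -
  have 1: "has_partials (\<lambda>x. X1 x \<bullet> n2 x) (X12 x \<bullet> n1 x + X2 x \<bullet> n11 x) (X22 x \<bullet> n1 x + X2 x \<bullet> n12 x) x"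
    by (rule has_partials_transform[OF has_partials_inner[OF partials(3) partials(5), OF x x] open_D x])
       (rule sff_symmetric)
  show "X11 x \<bullet> n2 x + X1 x \<bullet> n12 x = X12 x \<bullet> n1 x + X2 x \<bullet> n11 x"
    "X12 x \<bullet> n2 x + X1 x \<bullet> n22 x = X22 x \<bullet> n1 x + X2 x \<bullet> n12 x"
    using has_partials_unique[OF 1 has_partials_inner[OF partials(2) partials(6), OF x x]] by simp_all
qed

text \<open>The differentiated mean curvature equation turns the tangential parts of the traced
  second derivatives of \<open>n\<close> into first order data; this makes the equation for
  \<open>n \<bullet> e\<close> close up.\<close>

lemma weingarten_trace:
  assumes x: "x \<in> D"
  shows "G x * (X1 x \<bullet> n11 x) - 2 * F x * (X1 x \<bullet> n12 x) + E x * (X1 x \<bullet> n22 x)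
      = - \<Delta> x * (p' (X x \<bullet> e) * (X1 x \<bullet> e) * (n x \<bullet> e) + p (X x \<bullet> e) * (n1 x \<bullet> e)) + R x \<bullet> n1 x"
    "G x * (X2 x \<bullet> n11 x) - 2 * F x * (X2 x \<bullet> n12 x) + E x * (X2 x \<bullet> n22 x)
      = - \<Delta> x * (p' (X x \<bullet> e) * (X2 x \<bullet> e) * (n x \<bullet> e) + p (X x \<bullet> e) * (n2 x \<bullet> e)) + R x \<bullet> n2 x"
proof -
  define f where "f x = p (X x \<bullet> e) * (n x \<bullet> e)" for x
  define f1 where "f1 = p' (X x \<bullet> e) * (X1 x \<bullet> e) * (n x \<bullet> e) + p (X x \<bullet> e) * (n1 x \<bullet> e)"
  define f2 where "f2 = p' (X x \<bullet> e) * (X2 x \<bullet> e) * (n x \<bullet> e) + p (X x \<bullet> e) * (n2 x \<bullet> e)"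
  have Xe: "has_partials (\<lambda>x. X x \<bullet> e) (X1 x \<bullet> e) (X2 x \<bullet> e) x"
    using has_partials_inner[OF partials(1)[OF x] has_partials_const[of e]] by simp
  have ne: "has_partials (\<lambda>x. n x \<bullet> e) (n1 x \<bullet> e) (n2 x \<bullet> e) x"
    using has_partials_inner[OF partials(4)[OF x] has_partials_const[of e]] by simp
  have fp: "has_partials f f1 f2 x"
    using has_partials_mult[OF has_partials_compose_real[OF Xe p(1)[OF height[OF x]]] ne]
    unfolding f_def[abs_def] f1_def f2_def .
  note P = has_partials_inner[OF partials(2) partials(5), OF x x]
    has_partials_inner[OF partials(2) partials(6), OF x x]
    has_partials_inner[OF partials(3) partials(6), OF x x]
  note EFG = E_partials[OF x] F_partials[OF x] G_partials[OF x]
  \<comment> \<open>The factor 2 as \<open>*\<^sub>R\<close> and the determinant as a difference of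
    products match the shapes that the rules in \<open>left\<close> and \<open>right\<close>
    produce.\<close>
  have H: "G x * (X1 x \<bullet> n1 x) - 2 *\<^sub>R (F x * (X1 x \<bullet> n2 x)) + E x * (X2 x \<bullet> n2 x)
      = (F x * F x - E x * G x) * f x" if "x \<in> D" for x
    using mean_curvature_eq[OF that] unfolding E_def F_def G_def f_def
    by (simp add: power2_eq_square algebra_simps)
  note left = has_partials_add[OF has_partials_diff[OF has_partials_mult[OF EFG(3) P(1)]
      has_partials_scaleR[OF has_partials_mult[OF EFG(2) P(2)]]] has_partials_mult[OF EFG(1) P(3)]]
  note right = has_partials_mult[OF has_partials_diff[OF has_partials_mult[OF EFG(2) EFG(2)]
      has_partials_mult[OF EFG(1) EFG(3)]] fp]
  note dH = has_partials_unique[OF has_partials_transform[OF left open_D x H] right]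
  have \<Delta>: "\<Delta> x \<noteq> 0" using \<Delta>_pos[OF x] by simp
  have H': "G x * (X1 x \<bullet> n1 x) - 2 * F x * (X1 x \<bullet> n2 x) + E x * (X2 x \<bullet> n2 x) = - \<Delta> x * f x"
    using H[OF x] by (simp add: \<Delta>_def power2_eq_square algebra_simps)
  show "G x * (X1 x \<bullet> n11 x) - 2 * F x * (X1 x \<bullet> n12 x) + E x * (X1 x \<bullet> n22 x)
      = - \<Delta> x * (p' (X x \<bullet> e) * (X1 x \<bullet> e) * (n x \<bullet> e) + p (X x \<bullet> e) * (n1 x \<bullet> e)) + R x \<bullet> n1 x"
    unfolding f1_def[symmetric] R_def
    by (rule traced_codazzi[OF unit[OF x] normal(1)[OF x] normal(2)[OF x] normal_derivs[OF x]
          E_def[symmetric] F_def[symmetric] G_def[symmetric] \<Delta>_def[symmetric] \<Delta>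
          refl refl sff_symmetric[OF x] refl codazzi[OF x] H'])
       (use dH(1) in \<open>simp add: \<Delta>_def power2_eq_square\<close>, algebra)
  show "G x * (X2 x \<bullet> n11 x) - 2 * F x * (X2 x \<bullet> n12 x) + E x * (X2 x \<bullet> n22 x)
      = - \<Delta> x * (p' (X x \<bullet> e) * (X2 x \<bullet> e) * (n x \<bullet> e) + p (X x \<bullet> e) * (n2 x \<bullet> e)) + R x \<bullet> n2 x"
  proof -
    have "E x * (X2 x \<bullet> n22 x) - 2 * F x * (X2 x \<bullet> n12 x) + G x * (X2 x \<bullet> n11 x)
      = - \<Delta> x * f2 + (E x *\<^sub>R X22 x - (2 * F x) *\<^sub>R X12 x + G x *\<^sub>R X11 x) \<bullet> n2 x"
    proof (rule traced_codazzi[OF unit[OF x] normal(2)[OF x] normal(1)[OF x] normal_derivs(2)[OF x]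
          normal_derivs(1)[OF x] G_def[symmetric] _ E_def[symmetric] _ \<Delta>
          refl sff_symmetric[OF x] refl refl codazzi(2)[OF x, symmetric] codazzi(1)[OF x, symmetric]])
      show "X2 x \<bullet> X1 x = F x" by (simp add: F_def inner_commute)
      show "G x * E x - (F x)\<^sup>2 = \<Delta> x" by (simp add: \<Delta>_def)
      show "E x * (X2 x \<bullet> n2 x) - 2 * F x * (X1 x \<bullet> n2 x) + G x * (X1 x \<bullet> n1 x) = - \<Delta> x * f x"
        using H' by simp
    qed (use dH(2) codazzi(2)[OF x] in \<open>simp add: \<Delta>_def power2_eq_square
        inner_commute[of "X2 x" "X12 x"] inner_commute[of "X1 x" "X22 x"]\<close>, algebra)
    then show ?thesis unfolding f2_def[symmetric] R_def by (simp add: algebra_simps)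
  qed
qed

lemma expansion:
  assumes x: "x \<in> D"
  shows "\<Delta> x * (v \<bullet> w) = \<Delta> x * (v \<bullet> n x) * (w \<bullet> n x)
    + (G x * (v \<bullet> X1 x) - F x * (v \<bullet> X2 x)) * (w \<bullet> X1 x)
    + (E x * (v \<bullet> X2 x) - F x * (v \<bullet> X1 x)) * (w \<bullet> X2 x)"
  using frame_expansion_inner[OF unit[OF x] normal[OF x], of "\<Delta> x" v w] \<Delta>_pos[OF x]
  unfolding \<Delta>_def E_def F_def G_def by simp

lemma angle_derivs:
  assumes x: "x \<in> D"
  shows "\<Delta> x * (n1 x \<bullet> e) = t1 x * (X1 x \<bullet> n1 x) + t2 x * (X1 x \<bullet> n2 x)"
    "\<Delta> x * (n2 x \<bullet> e) = t1 x * (X1 x \<bullet> n2 x) + t2 x * (X2 x \<bullet> n2 x)"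
  using expansion[OF x, of e "n1 x"] expansion[OF x, of e "n2 x"] normal_derivs[OF x] sff_symmetric[OF x]
  unfolding t1_def t2_def by (simp_all add: inner_commute)

text \<open>\<open>b1\<close> and \<open>b2\<close> are \<Delta>^2 times the drift along the height
  gradient minus the traced Christoffel symbols, the first order part of the Laplacian in
  coordinates.\<close>

definition "b1 x = \<Delta> x * p (X x \<bullet> e) * t1 x - (G x * (R x \<bullet> X1 x) - F x * (R x \<bullet> X2 x))"
definition "b2 x = \<Delta> x * p (X x \<bullet> e) * t2 x - (E x * (R x \<bullet> X2 x) - F x * (R x \<bullet> X1 x))"
text \<open>\<Delta>^2 times \<open>|A|\<^sup>2 + p' |\<nabla>\<mu>|\<^sup>2\<close>, where \<mu> is
  the height.\<close>

definition "c x = \<Delta> x * K x + \<Delta> x * p' (X x \<bullet> e) * (t1 x * (X1 x \<bullet> e) + t2 x * (X2 x \<bullet> e))"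

text \<open>Each second derivative of \<open>n\<close> is paired with \<open>e\<close> through the
  frame: the normal component yields \<open>K\<close>, and the tangential ones are given by
  \<open>weingarten_trace\<close>.\<close>

lemma jacobi_equation:
  assumes x: "x \<in> D"
  shows "\<Delta> x * G x * (n11 x \<bullet> e) + 2 * (- \<Delta> x * F x) * (n12 x \<bullet> e) + \<Delta> x * E x * (n22 x \<bullet> e)
    + b1 x * (n1 x \<bullet> e) + b2 x * (n2 x \<bullet> e) + c x * (n x \<bullet> e) = 0"
proof -
  have \<nu>: "\<Delta> x * (w \<bullet> e) = \<Delta> x * (n x \<bullet> e) * (w \<bullet> n x) + t1 x * (X1 x \<bullet> w) + t2 x * (X2 x \<bullet> w)" for w
    using expansion[OF x, of e w] unfolding t1_def t2_def by (simp add: inner_commute)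
  have Rn: "\<Delta> x * (R x \<bullet> n1 x) = (G x * (R x \<bullet> X1 x) - F x * (R x \<bullet> X2 x)) * (X1 x \<bullet> n1 x)
      + (E x * (R x \<bullet> X2 x) - F x * (R x \<bullet> X1 x)) * (X1 x \<bullet> n2 x)"
    "\<Delta> x * (R x \<bullet> n2 x) = (G x * (R x \<bullet> X1 x) - F x * (R x \<bullet> X2 x)) * (X1 x \<bullet> n2 x)
      + (E x * (R x \<bullet> X2 x) - F x * (R x \<bullet> X1 x)) * (X2 x \<bullet> n2 x)"
    using expansion[OF x, of "R x" "n1 x"] expansion[OF x, of "R x" "n2 x"]
      normal_derivs[OF x] sff_symmetric[OF x] by (simp_all add: inner_commute)
  \<comment> \<open>By symmetry of the second fundamental form, pairing it with \<open>t\<close> and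
    the tangential part of \<open>R\<close> only involves first derivatives of
    \<open>n \<bullet> e\<close>.\<close>
  have "\<Delta> x * (t1 x * (R x \<bullet> n1 x) + t2 x * (R x \<bullet> n2 x))
     = \<Delta> x * ((G x * (R x \<bullet> X1 x) - F x * (R x \<bullet> X2 x)) * (n1 x \<bullet> e)
          + (E x * (R x \<bullet> X2 x) - F x * (R x \<bullet> X1 x)) * (n2 x \<bullet> e))"
    using Rn angle_derivs[OF x] by algebra
  then have tR: "t1 x * (R x \<bullet> n1 x) + t2 x * (R x \<bullet> n2 x)
     = (G x * (R x \<bullet> X1 x) - F x * (R x \<bullet> X2 x)) * (n1 x \<bullet> e)
          + (E x * (R x \<bullet> X2 x) - F x * (R x \<bullet> X1 x)) * (n2 x \<bullet> e)"
    using \<Delta>_pos[OF x] by simp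
  have "G x * (\<Delta> x * (n11 x \<bullet> e)) - 2 * F x * (\<Delta> x * (n12 x \<bullet> e)) + E x * (\<Delta> x * (n22 x \<bullet> e))
    = - (n x \<bullet> e) * \<Delta> x * K x
      + t1 x * (G x * (X1 x \<bullet> n11 x) - 2 * F x * (X1 x \<bullet> n12 x) + E x * (X1 x \<bullet> n22 x))
      + t2 x * (G x * (X2 x \<bullet> n11 x) - 2 * F x * (X2 x \<bullet> n12 x) + E x * (X2 x \<bullet> n22 x))"
    unfolding \<nu>[of "n11 x"] \<nu>[of "n12 x"] \<nu>[of "n22 x"] normal_second_derivs[OF x] K_def
    by (simp add: algebra_simps)
  then show ?thesis
    unfolding weingarten_trace[OF x] b1_def b2_def c_def using tR by algebra
qed

lemma angle_zero_propagates:
  assumes D: "connected D" and nonneg: "\<And>x. x \<in> D \<Longrightarrow> n x \<bullet> e \<ge> 0"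
    and z: "z \<in> D" "n z \<bullet> e = 0" and x: "x \<in> D"
  shows "n x \<bullet> e = 0"
proof -
  note cX = has_jet2_on_continuous[OF X_jet] and cn = has_jet2_on_continuous[OF n_jet]
  have cE: "continuous_on D E" "continuous_on D F" "continuous_on D G"
    unfolding E_def[abs_def] F_def[abs_def] G_def[abs_def] by (intro continuous_intros cX)+
  then have cD: "continuous_on D \<Delta>" unfolding \<Delta>_def[abs_def] by (intro continuous_intros)
  have cR: "continuous_on D R" unfolding R_def[abs_def] by (intro continuous_intros cE X_cont)
  have ct: "continuous_on D t1" "continuous_on D t2"
    unfolding t1_def[abs_def] t2_def[abs_def] by (intro continuous_intros cE cX)+
  have cXe: "continuous_on D (\<lambda>x. X x \<bullet> e)" by (intro continuous_intros cX)
  have "continuous_on I p"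
    using p(1) by (meson DERIV_isCont continuous_at_imp_continuous_on)
  then have cp: "continuous_on D (\<lambda>x. p (X x \<bullet> e))"
    by (rule continuous_on_compose2[OF _ cXe]) (use height in auto)
  have cp': "continuous_on D (\<lambda>x. p' (X x \<bullet> e))"
    by (rule continuous_on_compose2[OF p(2) cXe]) (use height in auto)
  interpret elliptic_operator D "\<lambda>x. \<Delta> x * G x" "\<lambda>x. - \<Delta> x * F x" "\<lambda>x. \<Delta> x * E x" b1 b2 c
  proof
    show "open D" by (rule open_D)
    show "continuous_on D (\<lambda>x. \<Delta> x * G x)" "continuous_on D (\<lambda>x. - \<Delta> x * F x)"
      "continuous_on D (\<lambda>x. \<Delta> x * E x)" by (intro continuous_intros cE cD)+
    show "continuous_on D b1" "continuous_on D b2" "continuous_on D c"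
      unfolding b1_def[abs_def] b2_def[abs_def] c_def[abs_def] K_def
      by (intro continuous_intros cE cD cR ct cp cp' cX cn)+
    show "\<Delta> x * G x > 0" if "x \<in> D" for x using \<Delta>_pos[OF that] G_pos[OF that] by simp
    show "\<Delta> x * G x * (\<Delta> x * E x) - (- \<Delta> x * F x)\<^sup>2 > 0" if "x \<in> D" for x
    proof -
      have "\<Delta> x * G x * (\<Delta> x * E x) - (- \<Delta> x * F x)\<^sup>2 = \<Delta> x * \<Delta> x * \<Delta> x"
        by (simp add: \<Delta>_def power2_eq_square algebra_simps)
      then show ?thesis using \<Delta>_pos[OF that] by simp
    qed
  qed
  show ?thesis
    by (rule strong_maximum_principle[OF has_jet2_on_inner[OF n_jet] _ nonneg D z x])
       (use jacobi_equation in simp_all)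
qed

lemma totally_geodesic_if_angle_zero:
  assumes e: "e \<noteq> 0" and zero: "\<And>x. x \<in> D \<Longrightarrow> n x \<bullet> e = 0" and x: "x \<in> D"
  shows "n1 x = 0" "n2 x = 0"
proof -
  have "has_partials (\<lambda>x. n x \<bullet> e) 0 0 x"
    by (rule has_partials_transform[OF has_partials_const open_D x]) (use zero in simp)
  from has_partials_unique[OF this has_partials_inner[OF partials(4)[OF x] has_partials_const[of e]]]
  have ne: "n1 x \<bullet> e = 0" "n2 x \<bullet> e = 0" by simp_all
  define \<mu>1 \<mu>2 where "\<mu>1 = e \<bullet> X1 x" and "\<mu>2 = e \<bullet> X2 x"
  define P11 P12 P22 where "P11 = X1 x \<bullet> n1 x" and "P12 = X1 x \<bullet> n2 x" and "P22 = X2 x \<bullet> n2 x"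
  have \<Delta>: "\<Delta> x > 0" by (rule \<Delta>_pos[OF x])
  have k: "t1 x * P11 + t2 x * P12 = 0" "t1 x * P12 + t2 x * P22 = 0"
    using angle_derivs[OF x] ne by (simp_all add: P11_def P12_def P22_def)
  have tr: "G x * P11 - 2 * F x * P12 + E x * P22 = 0"
    using mean_curvature_eq[OF x] zero[OF x] unfolding P11_def P12_def P22_def E_def F_def G_def by simp
  have "\<Delta> x * (e \<bullet> e) = t1 x * \<mu>1 + t2 x * \<mu>2"
    using expansion[OF x, of e e] zero[OF x]
    by (simp add: inner_commute t1_def t2_def \<mu>1_def \<mu>2_def)
  moreover have "\<Delta> x * \<mu>1 = E x * t1 x + F x * t2 x" "\<Delta> x * \<mu>2 = F x * t1 x + G x * t2 x"
    by (simp_all add: \<Delta>_def t1_def t2_def \<mu>1_def \<mu>2_def power2_eq_square algebra_simps)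
  \<comment> \<open>The metric evaluated at \<open>(t1, t2)\<close>, a multiple of the tangential
    part of \<open>e\<close>. Since \<open>e\<close> is now tangent and nonzero, this is
    positive.\<close>
  ultimately have Q: "\<Delta> x * (\<Delta> x * (e \<bullet> e)) = E x * (t1 x)\<^sup>2 + 2 * F x * t1 x * t2 x + G x * (t2 x)\<^sup>2"
    by (simp add: algebra_simps power2_eq_square) algebra
  have Qn: "E x * (t1 x)\<^sup>2 + 2 * F x * t1 x * t2 x + G x * (t2 x)\<^sup>2 \<noteq> 0"
    using Q[symmetric] \<Delta> e by simp
  \<comment> \<open>The two equations \<open>k\<close> and the trace equation form a linear system
    in \<open>P11\<close>, \<open>P12\<close>, \<open>P22\<close> whose determinant is this
    quadratic form.\<close>
  have "P11 * (E x * (t1 x)\<^sup>2 + 2 * F x * t1 x * t2 x + G x * (t2 x)\<^sup>2) = 0"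
    "P12 * (E x * (t1 x)\<^sup>2 + 2 * F x * t1 x * t2 x + G x * (t2 x)\<^sup>2) = 0"
    "P22 * (E x * (t1 x)\<^sup>2 + 2 * F x * t1 x * t2 x + G x * (t2 x)\<^sup>2) = 0"
    using k tr by algebra+
  then have "P11 = 0" "P12 = 0" "P22 = 0" using Qn by simp_all
  then have "n1 x \<bullet> n1 x = 0" "n2 x \<bullet> n2 x = 0"
    using expansion[OF x, of "n1 x" "n1 x"] expansion[OF x, of "n2 x" "n2 x"] \<Delta>
      normal_derivs[OF x] sff_symmetric[OF x]
    by (simp_all add: P11_def P12_def P22_def inner_commute)
  then show "n1 x = 0" "n2 x = 0" by simp_all
qed

end

section \<open>Smooth maps in charts\<close>

text \<open>\<open>frechet_derivative\<close> is a choice, so it agrees for two functions as soon as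
  they have the same derivatives, even where uniqueness is not known.\<close>

lemma frechet_derivative_cong:
  assumes "x \<in> C" "\<And>y. y \<in> C \<Longrightarrow> f y = g y"
  shows "frechet_derivative f (at x within C) = frechet_derivative g (at x within C)"
proof -
  have "(f has_derivative f') (at x within C) \<longleftrightarrow> (g has_derivative f') (at x within C)" for f'
    using assms has_derivative_transform[of x C f g f'] has_derivative_transform[of x C g f f'] by auto
  then show ?thesis unfolding frechet_derivative_def by simp
qed

lemma Ck_on_cong:
  assumes "Ck_on k f C" "\<And>y. y \<in> C \<Longrightarrow> f y = g y"
  shows "Ck_on k g C"
  using assms
proof (induction k arbitrary: f g)
  case 0
  then show ?case using continuous_on_cong[of C C f g] by simp
next
  case (Suc k)
  have "g differentiable_on C"
    using Suc.prems has_derivative_transform[of _ C g f]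
    unfolding Ck_on.simps differentiable_on_def differentiable_def by metis
  moreover have "Ck_on k (\<lambda>x. frechet_derivative g (at x within C) v) C" for v
  proof (rule Suc.IH)
    show "Ck_on k (\<lambda>x. frechet_derivative f (at x within C) v) C" using Suc.prems by simp
    show "frechet_derivative f (at y within C) v = frechet_derivative g (at y within C) v" if "y \<in> C" for y
      using frechet_derivative_cong[OF that] Suc.prems(2) by metis
  qed
  ultimately show ?case by simp
qed

lemma Ck_on_continuous: "Ck_on k f C \<Longrightarrow> continuous_on C f"
  by (cases k) (auto intro: differentiable_imp_continuous_on)

lemma Ck_on_real_deriv:
  fixes f :: "real \<Rightarrow> real"
  assumes f: "Ck_on (Suc k) f I" and I: "open I"
  shows "z \<in> I \<Longrightarrow> (f has_real_derivative deriv f z) (at z)" "Ck_on k (deriv f) I"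
proof -
  have der: "(f has_real_derivative frechet_derivative f (at z within I) 1) (at z)" if z: "z \<in> I" for z
  proof -
    have "(f has_derivative frechet_derivative f (at z within I)) (at z within I)"
      using f z unfolding Ck_on.simps differentiable_on_def by (simp add: frechet_derivative_works)
    then have "(f has_derivative frechet_derivative f (at z within I)) (at z)"
      using at_within_open[OF z I] by simp
    moreover from this have "frechet_derivative f (at z within I) = (*) (frechet_derivative f (at z within I) 1)"
      using linear_scale[OF has_derivative_linear, of f _ _ _ 1] by (simp add: fun_eq_iff mult.commute)
    ultimately show ?thesis unfolding has_field_derivative_def by simp
  qed
  show "z \<in> I \<Longrightarrow> (f has_real_derivative deriv f z) (at z)"
    using der DERIV_imp_deriv by metis
  have "Ck_on k (\<lambda>z. frechet_derivative f (at z within I) 1) I" using f by simp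
  then show "Ck_on k (deriv f) I"
    by (rule Ck_on_cong) (use der DERIV_imp_deriv in metis)
qed

text \<open>The hypothesis says that \<open>exp (lam * \<phi>)\<close> is convex, so a zero of its derivative would force it
  to be nonincreasing to the left of that zero.\<close>

lemma deriv_pos_if_exp_convex:
  fixes \<phi> :: "real \<Rightarrow> real"
  assumes smooth: "Ck_on 2 \<phi> I" and I: "open I" "is_interval I"
    and mono: "strict_mono_on I \<phi>"
    and ineq: "\<And>z. z \<in> I \<Longrightarrow> deriv (deriv \<phi>) z + lam * (deriv \<phi> z)\<^sup>2 \<ge> 0"
    and z: "z \<in> I"
  shows "deriv \<phi> z > 0"
proof (rule ccontr)
  assume neg: "\<not> deriv \<phi> z > 0"
  have C2: "Ck_on (Suc (Suc 0)) \<phi> I" using smooth by (simp add: numeral_2_eq_2)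
  note d1 = Ck_on_real_deriv(1)[OF C2 I(1)]
    and d2 = Ck_on_real_deriv(1)[OF Ck_on_real_deriv(2)[OF C2 I(1)] I(1)]
  obtain r where r: "r > 0" "ball z r \<subseteq> I" using I(1) z open_contains_ball by blast
  define y where "y = z - r / 2"
  have y: "y < z" "y \<in> I" using r by (auto simp: y_def dist_real_def subset_iff)
  have yz: "x \<in> I" if "y \<le> x" "x \<le> z" for x
    using I(2) y(2) z that unfolding is_interval_1 by blast
  \<comment> \<open>\<open>lam * q\<close> is the derivative of \<open>exp (lam * \<phi>)\<close>;
    the derivative of \<open>q\<close> is the assumed nonnegative expression times a positive
    factor.\<close>
  define q where "q x = deriv \<phi> x * exp (lam * \<phi> x)" for x
  have q: "(q has_real_derivative (deriv (deriv \<phi>) x + lam * (deriv \<phi> x)\<^sup>2) * exp (lam * \<phi> x)) (at x)"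
    if "x \<in> I" for x
    unfolding q_def
    by (rule derivative_eq_intros d1[OF that] d2[OF that] refl)+
       (simp add: power2_eq_square algebra_simps)
  have "deriv \<phi> x \<le> 0" if x: "y \<le> x" "x \<le> z" for x
  proof -
    have "q x \<le> q z"
    proof (rule DERIV_nonneg_imp_nondecreasing[OF x(2)])
      fix t assume "x \<le> t" "t \<le> z"
      then have "t \<in> I" using x yz by auto
      then show "\<exists>d. (q has_real_derivative d) (at t) \<and> 0 \<le> d" using q ineq by fastforce
    qed
    also have "q z \<le> 0" using neg by (simp add: q_def mult_nonpos_nonneg)
    finally show ?thesis by (simp add: q_def mult_le_0_iff not_le)
  qed
  then have "\<phi> z \<le> \<phi> y"
    using y(1) d1 yz by (intro DERIV_nonpos_imp_nonincreasing[of y z \<phi>]) (auto intro!: exI)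
  then show False using mono y z unfolding strict_mono_on_def by fastforce
qed

text \<open>\<open>C\<close> stays the whole chart image, where derivatives may be one-sided, while
  the equations are used on open subsets, where they are ordinary derivatives.\<close>

definition partial_in :: "(real^2) set \<Rightarrow> real^2 \<Rightarrow> (real^2 \<Rightarrow> 'b::real_normed_vector) \<Rightarrow> real^2 \<Rightarrow> 'b" where
  "partial_in C v f x = frechet_derivative f (at x within C) v"

abbreviation "pd1 C \<equiv> partial_in C (axis 1 1)"
abbreviation "pd2 C \<equiv> partial_in C (axis 2 1)"

lemma Ck_on_partial: "Ck_on (Suc k) f C \<Longrightarrow> Ck_on k (partial_in C v f) C"
  unfolding partial_in_def[abs_def] by simp

lemma real2_eq_axis: "h = h$1 *\<^sub>R axis 1 1 + h$2 *\<^sub>R (axis 2 1 :: real^2)"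
  by (simp add: vec_eq_iff forall_2 axis_def)

lemma linear_real2: "linear f \<Longrightarrow> f h = h$1 *\<^sub>R f (axis 1 1) + h$2 *\<^sub>R f (axis 2 1 :: real^2)"
  by (subst real2_eq_axis) (simp only: linear_add linear_scale)

lemma differentiable_on_frechet:
  "f differentiable_on C \<Longrightarrow> x \<in> C \<Longrightarrow> (f has_derivative frechet_derivative f (at x within C)) (at x within C)"
  by (simp add: differentiable_on_def frechet_derivative_works)

lemma partial_in_linear:
  assumes "Ck_on (Suc k) f C" "x \<in> C"
  shows "partial_in C h f x = h$1 *\<^sub>R pd1 C f x + h$2 *\<^sub>R pd2 C f x"
  unfolding partial_in_def
  by (rule linear_real2, rule has_derivative_linear, rule differentiable_on_frechet)
     (use assms in auto)

lemma Ck_on_has_derivative: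
  assumes "Ck_on (Suc k) f C" "open D" "D \<subseteq> C" "x \<in> D"
  shows "(f has_derivative (\<lambda>h. partial_in C h f x)) (at x)"
proof -
  have "at x within C = at x" using assms interiorI at_within_interior by metis
  then show ?thesis
    using differentiable_on_frechet[of f C x] assms unfolding partial_in_def by auto
qed

lemma Ck_on_has_partials:
  assumes "Ck_on (Suc k) f C" "open D" "D \<subseteq> C" "x \<in> D"
  shows "has_partials f (pd1 C f x) (pd2 C f x) x"
  using Ck_on_has_derivative[OF assms] partial_in_linear[OF assms(1)] assms(3,4)
  unfolding has_partials_def by (metis (no_types, lifting) has_derivative_eq_rhs subsetD ext)

lemma partials_commute:
  fixes f :: "real^2 \<Rightarrow> 'b::real_inner"
  assumes f: "Ck_on (Suc (Suc k)) f C" and D: "open D" "D \<subseteq> C" "x \<in> D"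
  shows "partial_in C u (partial_in C v f) x = partial_in C v (partial_in C u f) x"
  by (rule symmetric_second_derivative[OF D(1,3)
        Ck_on_has_derivative[OF f D(1,2)]
        Ck_on_has_derivative[OF Ck_on_partial[OF f] D]
        Ck_on_has_derivative[OF Ck_on_partial[OF f] D]])

lemma Ck_on_has_jet2:
  fixes f :: "real^2 \<Rightarrow> 'b::real_inner"
  assumes f: "Ck_on (Suc (Suc k)) f C" and D: "open D" "D \<subseteq> C"
  shows "has_jet2_on f (pd1 C f) (pd2 C f) (pd1 C (pd1 C f)) (pd1 C (pd2 C f)) (pd2 C (pd2 C f)) D"
  using Ck_on_has_partials[OF f D] Ck_on_has_partials[OF Ck_on_partial[OF f] D] partials_commute[OF f D]
  unfolding has_jet2_on_def by metis

section \<open>Metric traces, Gram determinants and normal projections\<close>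

text \<open>The determinant clears \<open>matrix_inv\<close>: the left inverse property alone gives
  four linear equations that determine its entries.\<close>

lemma metric_trace_adjugate:
  fixes g :: "real^2 \<Rightarrow> real^2 \<Rightarrow> real"
  assumes EFG: "g (axis 1 1) (axis 1 1) = E" "g (axis 1 1) (axis 2 1) = F" "g (axis 2 1) (axis 1 1) = F"
      "g (axis 2 1) (axis 2 1) = G"
    and det: "E * G - F\<^sup>2 \<noteq> 0"
  shows "(E * G - F\<^sup>2) *\<^sub>R metric_trace g B = G *\<^sub>R B (axis 1 1) (axis 1 1)
    - F *\<^sub>R B (axis 1 1) (axis 2 1) - F *\<^sub>R B (axis 2 1) (axis 1 1) + E *\<^sub>R B (axis 2 1) (axis 2 1)"
proof -
  define M where "M = ((\<chi> i j. g (axis i 1) (axis j 1)) :: real^2^2)"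
  have M: "M $ 1 $ 1 = E" "M $ 1 $ 2 = F" "M $ 2 $ 1 = F" "M $ 2 $ 2 = G"
    using EFG by (simp_all add: M_def)
  have "invertible M" using det M by (simp add: invertible_det_nz det_2 power2_eq_square)
  then have "matrix_inv M ** M = mat 1"
    unfolding invertible_def matrix_inv_def by (rule someI2_ex) blast
  then have *: "(matrix_inv M ** M) $ i $ j = (mat 1 :: real^2^2) $ i $ j" for i j by simp
  define a b c d where "a = matrix_inv M $ 1 $ 1" and "b = matrix_inv M $ 1 $ 2"
    and "c = matrix_inv M $ 2 $ 1" and "d = matrix_inv M $ 2 $ 2"
  have eqs: "a * E + b * F = 1" "a * F + b * G = 0" "c * E + d * F = 0" "c * F + d * G = 1"
    using *[of 1 1] *[of 1 2] *[of 2 1] *[of 2 2]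
    by (simp_all add: matrix_matrix_mult_def sum_2 mat_def M a_def b_def c_def d_def)
  have inv: "(E * G - F\<^sup>2) * a = G" "(E * G - F\<^sup>2) * b = - F" "(E * G - F\<^sup>2) * c = - F"
    "(E * G - F\<^sup>2) * d = E"
    using eqs by algebra+
  have "metric_trace g B = a *\<^sub>R B (axis 1 1) (axis 1 1) + b *\<^sub>R B (axis 1 1) (axis 2 1)
    + (c *\<^sub>R B (axis 2 1) (axis 1 1) + d *\<^sub>R B (axis 2 1) (axis 2 1))"
    unfolding metric_trace_def Let_def sum_2 a_def b_def c_def d_def M_def ..
  then have "(E * G - F\<^sup>2) *\<^sub>R metric_trace g B
    = ((E * G - F\<^sup>2) * a) *\<^sub>R B (axis 1 1) (axis 1 1) + ((E * G - F\<^sup>2) * b) *\<^sub>R B (axis 1 1) (axis 2 1)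
    + (((E * G - F\<^sup>2) * c) *\<^sub>R B (axis 2 1) (axis 1 1) + ((E * G - F\<^sup>2) * d) *\<^sub>R B (axis 2 1) (axis 2 1))"
    by (simp add: scaleR_add_right)
  then show ?thesis unfolding inv by simp
qed

lemma metric_trace_inner:
  fixes B :: "real^2 \<Rightarrow> real^2 \<Rightarrow> 'w::real_inner"
  shows "metric_trace g (\<lambda>u v. - (B u v \<bullet> w)) = - (metric_trace g B \<bullet> w)"
  unfolding metric_trace_def Let_def by (simp add: sum_2 inner_simps)

text \<open>Strict Cauchy-Schwarz: \<open>w\<close> is the unnormalised Gram-Schmidt vector, nonzero
  by independence, and its squared length is the determinant times
  \<open>x1 \<bullet> x1\<close>.\<close>

lemma gram_pos:
  fixes x1 x2 :: "'b::real_inner"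
  assumes inj: "inj (\<lambda>h::real^2. h$1 *\<^sub>R x1 + h$2 *\<^sub>R x2)"
  shows "(x1 \<bullet> x1) * (x2 \<bullet> x2) - (x1 \<bullet> x2)\<^sup>2 > 0"
proof -
  have indep: "s = 0 \<and> t = 0" if "s *\<^sub>R x1 + t *\<^sub>R x2 = 0" for s t
  proof -
    have "(vector [s, t] :: real^2) = 0"
      by (rule injD[OF inj]) (use that in simp)
    then have "(vector [s, t] :: real^2) $ 1 = 0" "(vector [s, t] :: real^2) $ 2 = 0" by simp_all
    then show ?thesis by simp
  qed
  have x1: "x1 \<bullet> x1 > 0" using indep[of 1 0] by auto
  define w where "w = (x1 \<bullet> x2) *\<^sub>R x1 - (x1 \<bullet> x1) *\<^sub>R x2"
  have "w \<noteq> 0"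
    using indep[of "x1 \<bullet> x2" "- (x1 \<bullet> x1)"] x1 unfolding w_def by auto
  then have "w \<bullet> w > 0" by simp
  moreover have "w \<bullet> w = (x1 \<bullet> x1) * ((x1 \<bullet> x1) * (x2 \<bullet> x2) - (x1 \<bullet> x2)\<^sup>2)"
    unfolding w_def by (simp add: inner_simps inner_commute[of x2 x1] power2_eq_square algebra_simps)
  ultimately show ?thesis using x1 by (simp add: zero_less_mult_iff)
qed

lemma normal_part_frame:
  fixes n x1 x2 w :: "real^3"
  assumes n: "n \<bullet> n = 1" "n \<bullet> x1 = 0" "n \<bullet> x2 = 0"
    and det: "(x1 \<bullet> x1) * (x2 \<bullet> x2) - (x1 \<bullet> x2)\<^sup>2 \<noteq> 0"
    and T: "T = range (\<lambda>h::real^2. h$1 *\<^sub>R x1 + h$2 *\<^sub>R x2)"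
  shows "normal_part T w = (w \<bullet> n) *\<^sub>R n"
proof -
  have inT: "s *\<^sub>R x1 + t *\<^sub>R x2 \<in> T" for s t
    unfolding T by (rule range_eqI[of _ _ "vector [s, t]"]) simp
  define \<Delta> where "\<Delta> = (x1 \<bullet> x1) * (x2 \<bullet> x2) - (x1 \<bullet> x2)\<^sup>2"
  define s where "s = (x2 \<bullet> x2) * (w \<bullet> x1) - (x1 \<bullet> x2) * (w \<bullet> x2)"
  define t where "t = (x1 \<bullet> x1) * (w \<bullet> x2) - (x1 \<bullet> x2) * (w \<bullet> x1)"
  have \<Delta>: "\<Delta> \<noteq> 0" using det by (simp add: \<Delta>_def)
  have "\<Delta> *\<^sub>R (w - (w \<bullet> n) *\<^sub>R n) = s *\<^sub>R x1 + t *\<^sub>R x2"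
    using frame_expansion[OF n \<Delta>_def[symmetric] \<Delta>, of w]
    unfolding s_def t_def by (simp add: scaleR_diff_right)
  then have "(1 / \<Delta>) *\<^sub>R \<Delta> *\<^sub>R (w - (w \<bullet> n) *\<^sub>R n) = (s / \<Delta>) *\<^sub>R x1 + (t / \<Delta>) *\<^sub>R x2"
    by (simp add: scaleR_add_right)
  then have w: "w - (w \<bullet> n) *\<^sub>R n = (s / \<Delta>) *\<^sub>R x1 + (t / \<Delta>) *\<^sub>R x2" using \<Delta> by simp
  show ?thesis unfolding normal_part_def
  proof (rule the_equality)
    show "(\<forall>t\<in>T. ((w \<bullet> n) *\<^sub>R n) \<bullet> t = 0) \<and> w - (w \<bullet> n) *\<^sub>R n \<in> T"
      unfolding w using inT n by (auto simp: T inner_simps)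
  next
    fix m assume m: "(\<forall>t\<in>T. m \<bullet> t = 0) \<and> w - m \<in> T"
    then obtain h :: "real^2" where h: "w - m = h$1 *\<^sub>R x1 + h$2 *\<^sub>R x2" unfolding T by auto
    have mx: "m \<bullet> x1 = 0" "m \<bullet> x2 = 0" using m inT[of 1 0] inT[of 0 1] by auto
    have "m \<bullet> n = w \<bullet> n - (w - m) \<bullet> n" by (simp add: inner_simps)
    also have "(w - m) \<bullet> n = 0" unfolding h using n by (simp add: inner_simps inner_commute)
    finally have mn: "m \<bullet> n = w \<bullet> n" by simp
    have "m - (w \<bullet> n) *\<^sub>R n = 0"
      by (rule orthogonal_frame_imp_zero[of n x1 x2])
         (use n det mx mn in \<open>auto simp: inner_simps\<close>)
    then show "m = (w \<bullet> n) *\<^sub>R n" by simp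
  qed
qed

section \<open>Density, connectedness and convex coordinate patches\<close>

lemma continuous_eq_const_on_dense:
  fixes f :: "'a::topological_space \<Rightarrow> 'b::t1_space"
  assumes "continuous_on V f" "D \<subseteq> V" "V \<subseteq> closure D" "\<And>x. x \<in> D \<Longrightarrow> f x = k" "x \<in> V"
  shows "f x = k"
proof -
  have "closedin (top_of_set V) {x \<in> V. f x = k}"
    by (rule continuous_closedin_preimage_constant[OF assms(1)])
  then obtain T where T: "closed T" "{x \<in> V. f x = k} = V \<inter> T" using closedin_closed by metis
  have "D \<subseteq> T" using assms T by blast
  then have "closure D \<subseteq> T" using T(1) by (rule closure_minimal)
  then show ?thesis using T(2) assms by blast
qed

text \<open>The codomain carries no topology; \<open>f\<close> is later a truth value and a pair of
  geometric quantities.\<close>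

lemma connected_space_locally_constant:
  assumes S: "connected_space S"
    and loc: "\<And>p. p \<in> topspace S \<Longrightarrow> \<exists>W. openin S W \<and> p \<in> W \<and> (\<forall>q\<in>W. f q = f p)"
    and pq: "p \<in> topspace S" "q \<in> topspace S"
  shows "f q = f p"
proof -
  have op: "openin S {q \<in> topspace S. f q \<in> A}" for A
  proof (subst openin_subopen, intro ballI)
    fix q assume q: "q \<in> {q \<in> topspace S. f q \<in> A}"
    then obtain W where W: "openin S W" "q \<in> W" "\<forall>r\<in>W. f r = f q" using loc by blast
    then have "r \<in> topspace S \<and> f r \<in> A" if "r \<in> W" for r
      using q openin_subset[OF W(1)] that by (metis (mono_tags, lifting) mem_Collect_eq subsetD)
    then have "W \<subseteq> {q \<in> topspace S. f q \<in> A}" by blast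
    then show "\<exists>T. openin S T \<and> q \<in> T \<and> T \<subseteq> {q \<in> topspace S. f q \<in> A}" using W by blast
  qed
  define Z where "Z = {q \<in> topspace S. f q \<in> {f p}}"
  have "openin S Z" unfolding Z_def by (rule op)
  moreover have "closedin S Z"
  proof -
    have "topspace S - Z = {q \<in> topspace S. f q \<in> - {f p}}" unfolding Z_def by auto
    then show ?thesis using op[of "- {f p}"] by (simp add: closedin_def Z_def)
  qed
  ultimately have "Z = {} \<or> Z = topspace S" using S unfolding connected_space_clopen_in by blast
  then show ?thesis using pq by (auto simp: Z_def)
qed

text \<open>A disc or a disc cut by the half-plane. Convexity with nonempty interior makes the
  interior both connected and dense in \<open>V\<close>, which is how boundary points are
  reached.\<close>

lemma half_plane_convex_neighbourhood:
  assumes C: "open C \<or> openin (top_of_set half_plane) C" and x: "x \<in> C"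
  obtains V where "x \<in> V" "convex V" "openin (top_of_set C) V" "interior V \<noteq> {}"
  using C
proof
  assume "open C"
  then obtain r where r: "r > 0" "ball x r \<subseteq> C" using x open_contains_ball by blast
  show thesis by (rule that[of "ball x r"]) (use r in \<open>auto intro!: open_subset\<close>)
next
  assume "openin (top_of_set half_plane) C"
  then obtain r where r: "r > 0" "ball x r \<inter> half_plane \<subseteq> C" and CH: "C \<subseteq> half_plane"
    using x unfolding openin_contains_ball by blast
  show thesis
  proof (rule that[of "ball x r \<inter> half_plane"])
    show "x \<in> ball x r \<inter> half_plane" using r x CH by auto
    show "convex (ball x r \<inter> half_plane)"
      unfolding half_plane_def
      by (intro convex_Int convex_ball) (auto simp: convex_def)
    have "ball x r \<inter> half_plane = C \<inter> ball x r" using r CH by auto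
    then show "openin (top_of_set C) (ball x r \<inter> half_plane)" by (simp add: openin_open_Int)
    have "x + (r/2) *\<^sub>R axis 1 1 \<in> ball x r \<inter> interior half_plane"
      using x CH r unfolding half_plane_def by (auto simp: dist_norm add_nonneg_pos)
    then show "interior (ball x r \<inter> half_plane) \<noteq> {}" by (auto simp: interior_open)
  qed
qed

locale drift_minimal_surface =
  fixes S :: "'a topology" and \<A> :: "'a chart set" and I :: "real set" and \<phi> :: "real \<Rightarrow> real"
    and \<psi> N :: "'a \<Rightarrow> real^3"
  assumes surface: "smooth_surface S \<A>"
    and I: "open I" and \<phi>: "smooth_on \<phi> I"
    and height: "\<And>p. p \<in> topspace S \<Longrightarrow> \<psi> p $ 3 \<in> I"
    and minimal: "minimal_immersion \<phi> \<A> \<psi>"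
    and gauss: "gauss_map \<A> \<psi> N"
begin

lemma charts_cover: "p \<in> topspace S \<Longrightarrow> \<exists>c\<in>\<A>. p \<in> fst c"
  using surface unfolding smooth_surface_def by auto

lemma chart_domain_open: "c \<in> \<A> \<Longrightarrow> openin S (fst c)"
  using surface unfolding smooth_surface_def surface_chart_def by blast

lemma chart_domain_subset: "c \<in> \<A> \<Longrightarrow> fst c \<subseteq> topspace S"
  using chart_domain_open openin_subset by blast

lemma chart_homeomorphic:
  "c \<in> \<A> \<Longrightarrow> homeomorphic_map (subtopology S (fst c)) (top_of_set (chart_image c)) (snd c)"
  using surface unfolding smooth_surface_def surface_chart_def by blast

lemma chart_inv_chart: "c \<in> \<A> \<Longrightarrow> p \<in> fst c \<Longrightarrow> chart_inv c (snd c p) = p"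
  using homeomorphic_imp_injective_map[OF chart_homeomorphic, of c] chart_domain_subset[of c]
  by (simp add: inv_into_f_f Int_absorb1)

lemma chart_preimage_open:
  assumes c: "c \<in> \<A>" and V: "openin (top_of_set (chart_image c)) V"
  shows "openin S (chart_inv c ` V)"
proof -
  have VC: "V \<subseteq> chart_image c" using openin_subset[OF V] by simp
  have sub: "chart_inv c ` V \<subseteq> fst c" using inv_into_into[OF subsetD[OF VC]] by blast
  have "snd c ` chart_inv c ` V = V" by (rule image_inv_into_cancel[OF refl VC])
  then have "openin (subtopology S (fst c)) (chart_inv c ` V)"
    using homeomorphic_map_openness_eq[OF chart_homeomorphic[OF c]] V sub chart_domain_subset[OF c] by auto
  then show ?thesis using openin_open_subtopology[OF chart_domain_open[OF c]] by simp
qed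

lemma smooth_in_chart:
  "c \<in> \<A> \<Longrightarrow> Ck_on k (\<psi> \<circ> chart_inv c) (chart_image c)"
  "c \<in> \<A> \<Longrightarrow> Ck_on k (N \<circ> chart_inv c) (chart_image c)"
  using minimal gauss
  unfolding minimal_immersion_def immersion_def gauss_map_def smooth_map_def smooth_on_def by blast+

lemma chart_deriv_eq: "chart_deriv c v f p = partial_in (chart_image c) v (f \<circ> chart_inv c) (snd c p)"
  by (simp add: chart_deriv_def partial_in_def)

lemma chart_deriv2_eq:
  assumes c: "c \<in> \<A>" and p: "p \<in> fst c"
  shows "chart_deriv c u (chart_deriv c v f) p
    = partial_in (chart_image c) u (partial_in (chart_image c) v (f \<circ> chart_inv c)) (snd c p)"
proof -
  have "frechet_derivative (chart_deriv c v f \<circ> chart_inv c) (at (snd c p) within chart_image c)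
     = frechet_derivative (partial_in (chart_image c) v (f \<circ> chart_inv c)) (at (snd c p) within chart_image c)"
    by (rule frechet_derivative_cong) (use p in \<open>auto simp: chart_deriv_eq f_inv_into_f\<close>)
  then show ?thesis by (simp add: chart_deriv_def[of c u] partial_in_def[of _ u])
qed

lemma chart_frame:
  fixes c p
  defines "x1 \<equiv> chart_deriv c (axis 1 1) \<psi> p" and "x2 \<equiv> chart_deriv c (axis 2 1) \<psi> p"
  assumes c: "c \<in> \<A>" and p: "p \<in> fst c"
  shows "chart_deriv c v \<psi> p = v$1 *\<^sub>R x1 + v$2 *\<^sub>R x2"
    and "N p \<bullet> N p = 1" "N p \<bullet> x1 = 0" "N p \<bullet> x2 = 0"
    and "(x1 \<bullet> x1) * (x2 \<bullet> x2) - (x1 \<bullet> x2)\<^sup>2 > 0"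
    and "normal_part (tangent_plane c \<psi> p) w = (w \<bullet> N p) *\<^sub>R N p"
proof -
  show lin: "chart_deriv c v \<psi> p = v$1 *\<^sub>R x1 + v$2 *\<^sub>R x2" for v
    unfolding x1_def x2_def chart_deriv_eq
    by (rule partial_in_linear[OF smooth_in_chart(1)[OF c]]) (use p in auto)
  have "norm (N p) = 1" using gauss c p unfolding gauss_map_def by blast
  then show NN: "N p \<bullet> N p = 1" by (simp add: norm_eq_1)
  have ort: "N p \<bullet> chart_deriv c v \<psi> p = 0" for v
    using gauss c p unfolding gauss_map_def tangent_plane_def by blast
  show Nx: "N p \<bullet> x1 = 0" "N p \<bullet> x2 = 0" unfolding x1_def x2_def by (rule ort)+
  have "inj (\<lambda>v. chart_deriv c v \<psi> p)"
    using minimal c p unfolding minimal_immersion_def immersion_def by blast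
  then show det: "(x1 \<bullet> x1) * (x2 \<bullet> x2) - (x1 \<bullet> x2)\<^sup>2 > 0" unfolding lin by (rule gram_pos)
  show "normal_part (tangent_plane c \<psi> p) w = (w \<bullet> N p) *\<^sub>R N p"
    by (rule normal_part_frame[OF NN Nx]) (use det in \<open>auto simp: tangent_plane_def lin\<close>)
qed

lemma mean_curvature_vector_eq:
  assumes c: "c \<in> \<A>" and p: "p \<in> fst c"
  shows "mean_curvature_vector c \<psi> p = (deriv \<phi> (\<psi> p $ 3) * (N p \<bullet> e3)) *\<^sub>R N p"
  using minimal c p chart_frame(6)[OF c p] unfolding minimal_immersion_def by (simp add: inner_commute)

text \<open>The chart picked by \<open>SOME\<close> drops out, because the minimality equation
  prescribes the mean curvature vector in every chart.\<close>

lemma mean_curvature_eq: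
  assumes p: "p \<in> topspace S"
  shows "mean_curvature \<A> \<psi> N p = - deriv \<phi> (\<psi> p $ 3) * (N p \<bullet> e3)"
proof -
  define c where "c = (SOME c. c \<in> \<A> \<and> p \<in> fst c)"
  have c: "c \<in> \<A>" "p \<in> fst c"
    using someI_ex[of "\<lambda>c. c \<in> \<A> \<and> p \<in> fst c"] charts_cover[OF p] unfolding c_def by blast+
  have "mean_curvature \<A> \<psi> N p = - (mean_curvature_vector c \<psi> p \<bullet> N p)"
    unfolding mean_curvature_def Let_def c_def[symmetric] scalar_sff_def[abs_def] metric_trace_inner
      mean_curvature_vector_def ..
  then show ?thesis using mean_curvature_vector_eq[OF c] chart_frame(2)[OF c] by simp
qed

lemma chart_patch:
  fixes c
  defines "C \<equiv> chart_image c" and "X \<equiv> \<psi> \<circ> chart_inv c" and "n \<equiv> N \<circ> chart_inv c"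
  assumes c: "c \<in> \<A>" and D: "open D" "D \<subseteq> C"
  shows "drift_minimal_patch D e3 I (deriv \<phi>) (deriv (deriv \<phi>))
    X (pd1 C X) (pd2 C X) (pd1 C (pd1 C X)) (pd1 C (pd2 C X)) (pd2 C (pd2 C X))
    n (pd1 C n) (pd2 C n) (pd1 C (pd1 C n)) (pd1 C (pd2 C n)) (pd2 C (pd2 C n))"
proof -
  have X: "Ck_on k X C" and n: "Ck_on k n C" for k
    unfolding X_def n_def C_def by (rule smooth_in_chart[OF c])+
  have inv: "chart_inv c x \<in> fst c" "snd c (chart_inv c x) = x" if "x \<in> D" for x
    using that D(2) unfolding C_def by (auto intro: inv_into_into f_inv_into_f)
  have fr1: "chart_deriv c v \<psi> (chart_inv c x) = partial_in C v X x" if "x \<in> D" for x v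
    unfolding chart_deriv_eq inv[OF that] C_def X_def ..
  have fr2: "chart_deriv c u (chart_deriv c v \<psi>) (chart_inv c x) = partial_in C u (partial_in C v X) x"
    if "x \<in> D" for x u v
    unfolding chart_deriv2_eq[OF c inv(1)[OF that]] inv[OF that] C_def X_def ..
  have nx: "n x = N (chart_inv c x)" for x by (simp add: n_def)
  have jX: "has_jet2_on X (pd1 C X) (pd2 C X) (pd1 C (pd1 C X)) (pd1 C (pd2 C X)) (pd2 C (pd2 C X)) D"
    by (rule Ck_on_has_jet2[OF X D])
  have jn: "has_jet2_on n (pd1 C n) (pd2 C n) (pd1 C (pd1 C n)) (pd1 C (pd2 C n)) (pd2 C (pd2 C n)) D"
    by (rule Ck_on_has_jet2[OF n D])
  have unit: "n x \<bullet> n x = 1" "n x \<bullet> pd1 C X x = 0" "n x \<bullet> pd2 C X x = 0" if x: "x \<in> D" for x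
    using chart_frame(2-4)[OF c inv(1)[OF x]] unfolding fr1[OF x] nx .
  have gram: "(pd1 C X x \<bullet> pd1 C X x) * (pd2 C X x \<bullet> pd2 C X x) - (pd1 C X x \<bullet> pd2 C X x)\<^sup>2 > 0"
    if x: "x \<in> D" for x
    using chart_frame(5)[OF c inv(1)[OF x]] unfolding fr1[OF x] .
  show ?thesis
  proof
    show "open D" by fact
    show "continuous_on D (pd1 C (pd1 C X))" "continuous_on D (pd1 C (pd2 C X))"
      "continuous_on D (pd2 C (pd2 C X))"
      by (rule continuous_on_subset[OF Ck_on_continuous[OF Ck_on_partial[OF Ck_on_partial[OF X[of "Suc (Suc 0)"]]]] D(2)])+
    show "X x \<bullet> e3 \<in> I" if "x \<in> D" for x
      using height[of "chart_inv c x"] inv(1)[OF that] chart_domain_subset[OF c]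
      by (auto simp: X_def e3_def inner_axis)
    show "(deriv \<phi> has_real_derivative deriv (deriv \<phi>) z) (at z)" if "z \<in> I" for z
      using Ck_on_real_deriv(1)[OF Ck_on_real_deriv(2)[of "Suc 0" \<phi> I] I that] \<phi> I
      unfolding smooth_on_def by simp
    show "continuous_on I (deriv (deriv \<phi>))"
      using Ck_on_continuous[OF Ck_on_real_deriv(2)[OF Ck_on_real_deriv(2)[of "Suc 0" \<phi>] I]] \<phi> I
      unfolding smooth_on_def by blast
    fix x assume x: "x \<in> D"
    have "has_partials (\<lambda>x. n x \<bullet> pd1 C X x) 0 0 x" "has_partials (\<lambda>x. n x \<bullet> pd2 C X x) 0 0 x"
      by (rule has_partials_transform[OF has_partials_const D(1) x]; use unit in simp)+
    note h1 = has_partials_unique[OF this(1) has_partials_inner[OF has_jet2_onD(1)[OF jn x] has_jet2_onD(2)[OF jX x]]]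
      and h2 = has_partials_unique[OF this(2) has_partials_inner[OF has_jet2_onD(1)[OF jn x] has_jet2_onD(3)[OF jX x]]]
    \<comment> \<open>Differentiating the orthogonality of \<open>n\<close> to the coordinate
      vectors moves the derivative from \<open>X\<close> to \<open>n\<close>.\<close>
    have sff: "pd1 C (pd1 C X) x \<bullet> n x = - (pd1 C X x \<bullet> pd1 C n x)"
      "pd1 C (pd2 C X) x \<bullet> n x = - (pd1 C X x \<bullet> pd2 C n x)"
      "pd2 C (pd2 C X) x \<bullet> n x = - (pd2 C X x \<bullet> pd2 C n x)"
      using h1 h2 by (simp_all add: inner_commute)
    have comm: "pd2 C (pd1 C X) x = pd1 C (pd2 C X) x"
      by (rule partials_commute[OF X D x])
    let ?E = "pd1 C X x \<bullet> pd1 C X x" and ?F = "pd1 C X x \<bullet> pd2 C X x" and ?G = "pd2 C X x \<bullet> pd2 C X x"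
    let ?p = "chart_inv c x"
    have vs: "vector_sff c \<psi> ?p u v \<bullet> n x = partial_in C u (partial_in C v X) x \<bullet> n x" for u v
      unfolding vector_sff_def chart_frame(6)[OF c inv(1)[OF x]] fr2[OF x] nx
      using chart_frame(2)[OF c inv(1)[OF x]] by simp
    have "(?E * ?G - ?F\<^sup>2) *\<^sub>R mean_curvature_vector c \<psi> ?p
      = ?G *\<^sub>R vector_sff c \<psi> ?p (axis 1 1) (axis 1 1) - ?F *\<^sub>R vector_sff c \<psi> ?p (axis 1 1) (axis 2 1)
      - ?F *\<^sub>R vector_sff c \<psi> ?p (axis 2 1) (axis 1 1) + ?E *\<^sub>R vector_sff c \<psi> ?p (axis 2 1) (axis 2 1)"
      unfolding mean_curvature_vector_def
      by (rule metric_trace_adjugate)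
         (use gram[OF x] in \<open>auto simp: induced_metric_def fr1[OF x] inner_commute\<close>)
    from arg_cong[OF this, of "\<lambda>w. w \<bullet> n x"]
    have "(?E * ?G - ?F\<^sup>2) * (mean_curvature_vector c \<psi> ?p \<bullet> n x)
      = - (?G * (pd1 C X x \<bullet> pd1 C n x) - 2 * ?F * (pd1 C X x \<bullet> pd2 C n x) + ?E * (pd2 C X x \<bullet> pd2 C n x))"
      by (simp add: inner_add_left inner_diff_left vs comm sff)
    moreover have "mean_curvature_vector c \<psi> ?p \<bullet> n x = deriv \<phi> (X x \<bullet> e3) * (n x \<bullet> e3)"
      unfolding mean_curvature_vector_eq[OF c inv(1)[OF x]] nx
      using chart_frame(2)[OF c inv(1)[OF x]] by (simp add: X_def e3_def inner_axis)
    ultimately have "(?E * ?G - ?F\<^sup>2) * (deriv \<phi> (X x \<bullet> e3) * (n x \<bullet> e3))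
      = - (?G * (pd1 C X x \<bullet> pd1 C n x) - 2 * ?F * (pd1 C X x \<bullet> pd2 C n x) + ?E * (pd2 C X x \<bullet> pd2 C n x))"
      by (simp only:)
    then show "?G * (pd1 C X x \<bullet> pd1 C n x) - 2 * ?F * (pd1 C X x \<bullet> pd2 C n x) + ?E * (pd2 C X x \<bullet> pd2 C n x)
      = - (?E * ?G - ?F\<^sup>2) * (deriv \<phi> (X x \<bullet> e3) * (n x \<bullet> e3))" by linarith
  qed (use jX jn unit gram in auto)
qed

lemma in_topspace: "c \<in> \<A> \<Longrightarrow> x \<in> chart_image c \<Longrightarrow> chart_inv c x \<in> topspace S"
  using subsetD[OF chart_domain_subset inv_into_into[of x "snd c" "fst c"]] .

lemma continuous_in_chart:
  assumes "c \<in> \<A>" "V \<subseteq> chart_image c"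
  shows "continuous_on V (\<lambda>x. \<psi> (chart_inv c x))" "continuous_on V (\<lambda>x. N (chart_inv c x))"
  using continuous_on_subset[OF Ck_on_continuous[OF smooth_in_chart(1)] assms(2)]
    continuous_on_subset[OF Ck_on_continuous[OF smooth_in_chart(2)] assms(2)] assms(1)
  unfolding comp_def by blast+

section \<open>From patches to the connected surface\<close>

lemma angle_zero_in_chart:
  assumes c: "c \<in> \<A>" and V: "convex V" "V \<subseteq> chart_image c"
    and nonneg: "\<And>p. p \<in> topspace S \<Longrightarrow> N p \<bullet> e3 \<ge> 0"
    and z: "z \<in> interior V" "N (chart_inv c z) \<bullet> e3 = 0" and x: "x \<in> V"
  shows "N (chart_inv c x) \<bullet> e3 = 0"
proof -
  have D: "interior V \<subseteq> chart_image c" using V interior_subset by blast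
  interpret drift_minimal_patch "interior V" e3 I "deriv \<phi>" "deriv (deriv \<phi>)"
    "\<psi> \<circ> chart_inv c" "pd1 (chart_image c) (\<psi> \<circ> chart_inv c)" "pd2 (chart_image c) (\<psi> \<circ> chart_inv c)"
    "pd1 (chart_image c) (pd1 (chart_image c) (\<psi> \<circ> chart_inv c))"
    "pd1 (chart_image c) (pd2 (chart_image c) (\<psi> \<circ> chart_inv c))"
    "pd2 (chart_image c) (pd2 (chart_image c) (\<psi> \<circ> chart_inv c))"
    "N \<circ> chart_inv c" "pd1 (chart_image c) (N \<circ> chart_inv c)" "pd2 (chart_image c) (N \<circ> chart_inv c)"
    "pd1 (chart_image c) (pd1 (chart_image c) (N \<circ> chart_inv c))"
    "pd1 (chart_image c) (pd2 (chart_image c) (N \<circ> chart_inv c))"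
    "pd2 (chart_image c) (pd2 (chart_image c) (N \<circ> chart_inv c))"
    by (rule chart_patch[OF c open_interior D])
  have "(N \<circ> chart_inv c) y \<bullet> e3 \<ge> 0" if "y \<in> interior V" for y
    using nonneg[OF in_topspace[OF c subsetD[OF D that]]] by simp
  then have "N (chart_inv c y) \<bullet> e3 = 0" if "y \<in> interior V" for y
    using angle_zero_propagates[OF convex_connected[OF convex_interior[OF V(1)]] _ z(1) _ that] z(2)
    by simp
  note zero = this
  have "V \<subseteq> closure (interior V)"
    using convex_closure_interior[OF V(1)] z(1) closure_subset by blast
  moreover have "continuous_on V (\<lambda>x. N (chart_inv c x) \<bullet> e3)"
    by (intro continuous_intros continuous_in_chart(2)[OF c V(2)])
  ultimately show ?thesis
    using continuous_eq_const_on_dense[of V "\<lambda>x. N (chart_inv c x) \<bullet> e3" "interior V"] zero x interior_subset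
    by blast
qed

text \<open>With \<open>n\<close> constant, the derivative of \<open>X \<bullet> n\<close> is a
  tangent vector paired with \<open>n\<close>, hence zero; density carries both constants to the
  boundary.\<close>

lemma planar_in_chart:
  assumes c: "c \<in> \<A>" and V: "convex V" "V \<subseteq> chart_image c" "interior V \<noteq> {}"
    and zero: "\<And>p. p \<in> topspace S \<Longrightarrow> N p \<bullet> e3 = 0" and x: "x \<in> V" "y \<in> V"
  shows "N (chart_inv c x) = N (chart_inv c y)"
    "\<psi> (chart_inv c x) \<bullet> N (chart_inv c x) = \<psi> (chart_inv c y) \<bullet> N (chart_inv c y)"
proof -
  define X n where "X = \<psi> \<circ> chart_inv c" and "n = N \<circ> chart_inv c"
  define C where "C = chart_image c"
  have D: "interior V \<subseteq> C" using V interior_subset unfolding C_def by blast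
  interpret drift_minimal_patch "interior V" e3 I "deriv \<phi>" "deriv (deriv \<phi>)"
    X "pd1 C X" "pd2 C X" "pd1 C (pd1 C X)" "pd1 C (pd2 C X)" "pd2 C (pd2 C X)"
    n "pd1 C n" "pd2 C n" "pd1 C (pd1 C n)" "pd1 C (pd2 C n)" "pd2 C (pd2 C n)"
    unfolding X_def n_def C_def by (rule chart_patch[OF c open_interior D[unfolded C_def]])
  have "e3 \<noteq> 0" by (simp add: e3_def)
  moreover have "n y \<bullet> e3 = 0" if "y \<in> interior V" for y
    using zero[OF in_topspace[OF c]] that D by (auto simp: n_def C_def)
  ultimately have n0: "pd1 C n y = 0" "pd2 C n y = 0" if "y \<in> interior V" for y
    using totally_geodesic_if_angle_zero that by blast+
  have "(n has_derivative (\<lambda>h. 0)) (at y within interior V)" if "y \<in> interior V" for y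
    using partials(4)[OF that] n0[OF that] unfolding has_partials_def
    by (auto intro: has_derivative_at_withinI)
  from has_derivative_zero_constant[OF convex_interior[OF V(1)] this]
  obtain k where k: "\<And>y. y \<in> interior V \<Longrightarrow> n y = k" by blast
  have "((\<lambda>y. X y \<bullet> n y) has_derivative (\<lambda>h. 0)) (at y within interior V)" if "y \<in> interior V" for y
  proof -
    have "pd1 C X y \<bullet> n y = 0" "pd2 C X y \<bullet> n y = 0"
      using normal[OF that] by (metis inner_commute)+
    then have "has_partials (\<lambda>y. X y \<bullet> n y) 0 0 y"
      using has_partials_inner[OF partials(1)[OF that] partials(4)[OF that]] n0[OF that] by simp
    then show ?thesis unfolding has_partials_def by (simp add: has_derivative_at_withinI)
  qed
  from has_derivative_zero_constant[OF convex_interior[OF V(1)] this]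
  obtain l where l: "\<And>y. y \<in> interior V \<Longrightarrow> X y \<bullet> n y = l" by blast
  have cl: "V \<subseteq> closure (interior V)"
    using convex_closure_interior[OF V(1,3)] closure_subset by blast
  have cn: "continuous_on V n" and cX: "continuous_on V X"
    using continuous_in_chart[OF c V(2)] by (simp_all add: X_def n_def comp_def)
  have "n y = k" if "y \<in> V" for y
    by (rule continuous_eq_const_on_dense[OF cn interior_subset cl k that])
  moreover have "X y \<bullet> n y = l" if "y \<in> V" for y
    by (rule continuous_eq_const_on_dense[OF _ interior_subset cl l that])
       (intro continuous_intros cn cX)
  ultimately show "N (chart_inv c x) = N (chart_inv c y)"
    "\<psi> (chart_inv c x) \<bullet> N (chart_inv c x) = \<psi> (chart_inv c y) \<bullet> N (chart_inv c y)"
    using x unfolding X_def n_def by auto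
qed

lemma convex_patch:
  assumes p: "p \<in> topspace S"
  obtains c V where "c \<in> \<A>" "p \<in> fst c" "convex V" "openin (top_of_set (chart_image c)) V"
    "snd c p \<in> V" "interior V \<noteq> {}"
proof -
  obtain c where c: "c \<in> \<A>" "p \<in> fst c" using charts_cover[OF p] by blast
  then have "open (chart_image c) \<or> openin (top_of_set half_plane) (chart_image c)"
    using surface unfolding smooth_surface_def surface_chart_def by blast
  then obtain V where "snd c p \<in> V" "convex V" "openin (top_of_set (chart_image c)) V" "interior V \<noteq> {}"
    by (rule half_plane_convex_neighbourhood[of "chart_image c" "snd c p"]) (use c in auto)
  then show thesis using that c by blast
qed

lemma angle_zero_everywhere:
  assumes conn: "connected_space S"
    and nonneg: "\<And>p. p \<in> topspace S \<Longrightarrow> N p \<bullet> e3 \<ge> 0"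
    and z: "z \<in> surface_interior \<A>" "N z \<bullet> e3 = 0" and p: "p \<in> topspace S"
  shows "N p \<bullet> e3 = 0"
proof -
  \<comment> \<open>The interior of the zero set, in the topology of the surface. An isolated zero
    at the boundary does not belong to it.\<close>
  define U where "U = {p. \<exists>W. openin S W \<and> p \<in> W \<and> (\<forall>q\<in>W. N q \<bullet> e3 = 0)}"
  have UI: "W \<subseteq> U" if "openin S W" "\<And>q. q \<in> W \<Longrightarrow> N q \<bullet> e3 = 0" for W
    using that unfolding U_def by blast
  obtain c where c: "c \<in> \<A>" "z \<in> fst c" "snd c z \<in> interior (chart_image c)"
    using z(1) unfolding surface_interior_def by blast
  then obtain r where r: "r > 0" "ball (snd c z) r \<subseteq> chart_image c" using mem_interior by blast
  have "chart_inv c ` ball (snd c z) r \<subseteq> U"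
  proof (rule UI)
    show "openin S (chart_inv c ` ball (snd c z) r)"
      by (rule chart_preimage_open[OF c(1)]) (use r in \<open>auto intro: open_subset\<close>)
    fix q assume "q \<in> chart_inv c ` ball (snd c z) r"
    then obtain x where x: "q = chart_inv c x" "x \<in> ball (snd c z) r" by blast
    show "N q \<bullet> e3 = 0" unfolding x(1)
      by (rule angle_zero_in_chart[OF c(1) convex_ball r(2) nonneg _ _ x(2), where z = "snd c z"])
         (use r z(2) chart_inv_chart[OF c(1,2)] in \<open>auto simp: interior_open\<close>)
  qed
  then have zU: "z \<in> U" using chart_inv_chart[OF c(1,2)] r(1) by (metis centre_in_ball image_eqI subsetD)
  have zS: "z \<in> topspace S" using c chart_domain_subset by blast
  have "(p \<in> U) = (z \<in> U)"
  proof (rule connected_space_locally_constant[OF conn _ zS p])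
    fix p assume p: "p \<in> topspace S"
    obtain c V where c: "c \<in> \<A>" "p \<in> fst c" and V: "convex V" "openin (top_of_set (chart_image c)) V"
      "snd c p \<in> V" "interior V \<noteq> {}" using convex_patch[OF p] .
    have VC: "V \<subseteq> chart_image c" using openin_subset[OF V(2)] by simp
    define W where "W = chart_inv c ` V"
    have W: "openin S W" "p \<in> W"
      using chart_preimage_open[OF c(1) V(2)] V(3) chart_inv_chart[OF c] unfolding W_def by force+
    have Wc: "W \<subseteq> fst c" using inv_into_into[OF subsetD[OF VC]] unfolding W_def by blast
    \<comment> \<open>Each patch lies in \<open>U\<close> or misses it, so membership in
      \<open>U\<close> is locally constant.\<close>
    have "W \<subseteq> U" if q: "q \<in> W" "q \<in> U" for q
    proof -
      obtain O' where O': "openin S O'" "q \<in> O'" "\<forall>q\<in>O'. N q \<bullet> e3 = 0" using q(2) unfolding U_def by blast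
      have "openin S (O' \<inter> W)" by (rule openin_Int[OF O'(1) W(1)])
      then have "openin (subtopology S (fst c)) (O' \<inter> W)"
        using openin_open_subtopology[OF chart_domain_open[OF c(1)]] Wc by blast
      then have "openin (top_of_set (chart_image c)) (snd c ` (O' \<inter> W))"
        using homeomorphic_map_openness_eq[OF chart_homeomorphic[OF c(1)]] by blast
      then obtain T where T: "open T" "snd c ` (O' \<inter> W) = chart_image c \<inter> T"
        unfolding openin_open by blast
      have WV: "snd c q \<in> V" if "q \<in> W" for q
        using that VC unfolding W_def by (auto simp: f_inv_into_f subset_iff)
      have "snd c q \<in> T" "snd c q \<in> V" using T(2) q O' WV by blast+
      moreover have "V \<subseteq> closure (interior V)"
        using convex_closure_interior[OF V(1,4)] closure_subset by blast
      \<comment> \<open>Even if \<open>q\<close> is a boundary point, its neighbourhood of zeros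
        meets the dense interior of \<open>V\<close>, which supplies the interior zero for
        \<open>angle_zero_in_chart\<close>.\<close>
      ultimately have "T \<inter> interior V \<noteq> {}"
        using open_Int_closure_eq_empty[OF T(1), of "interior V"] by blast
      then obtain y where y: "y \<in> T" "y \<in> interior V" by blast
      then have "y \<in> snd c ` (O' \<inter> W)" unfolding T(2) using VC interior_subset by blast
      then obtain q' where q': "q' \<in> O'" "q' \<in> W" "y = snd c q'" by blast
      have "q' \<in> fst c" using q'(2) Wc by blast
      then have "N (chart_inv c y) \<bullet> e3 = 0" using O' q' chart_inv_chart[OF c(1)] by simp
      then have "N q \<bullet> e3 = 0" if "q \<in> W" for q
        using angle_zero_in_chart[OF c(1) V(1) VC nonneg y(2)] that unfolding W_def by blast
      then show ?thesis by (rule UI[OF W(1)])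
    qed
    then show "\<exists>W. openin S W \<and> p \<in> W \<and> (\<forall>q\<in>W. (q \<in> U) = (p \<in> U))" using W by blast
  qed
  then show ?thesis using zU unfolding U_def by blast
qed

lemma image_planar:
  assumes conn: "connected_space S" and zero: "\<And>p. p \<in> topspace S \<Longrightarrow> N p \<bullet> e3 = 0"
    and p: "p \<in> topspace S" "q \<in> topspace S"
  shows "N p \<bullet> \<psi> q = N p \<bullet> \<psi> p"
proof -
  \<comment> \<open>Normal and support value together determine the tangent plane in space, so one
    connectedness argument fixes it.\<close>
  have "(N q, \<psi> q \<bullet> N q) = (N p, \<psi> p \<bullet> N p)"
  proof (rule connected_space_locally_constant[OF conn _ p])
    fix p assume p: "p \<in> topspace S"
    obtain c V where c: "c \<in> \<A>" "p \<in> fst c" and V: "convex V" "openin (top_of_set (chart_image c)) V"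
      "snd c p \<in> V" "interior V \<noteq> {}" using convex_patch[OF p] .
    have VC: "V \<subseteq> chart_image c" using openin_subset[OF V(2)] by simp
    have "(N (chart_inv c x), \<psi> (chart_inv c x) \<bullet> N (chart_inv c x)) = (N p, \<psi> p \<bullet> N p)" if "x \<in> V" for x
      using planar_in_chart[OF c(1) V(1) VC V(4) zero that V(3)] chart_inv_chart[OF c] by simp
    then show "\<exists>W. openin S W \<and> p \<in> W \<and> (\<forall>q\<in>W. (N q, \<psi> q \<bullet> N q) = (N p, \<psi> p \<bullet> N p))"
      using chart_preimage_open[OF c(1) V(2)] V(3) chart_inv_chart[OF c] by (intro exI[of _ "chart_inv c ` V"]) force
  qed
  then show ?thesis by (auto simp: inner_commute)
qed

end

theorem theorem2p4:
  fixes S :: "'a topology" and \<A> :: "'a chart set"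
    and a b :: ereal and \<phi> :: "real \<Rightarrow> real" and lam :: real
    and \<psi> N :: "'a \<Rightarrow> real^3"
  assumes surface: "smooth_surface S \<A>" "connected_space S"
    and phi_smooth: "smooth_on \<phi> (einterval a b)"
    and phi_increasing: "strict_mono_on (einterval a b) \<phi>"
    and lambda_pos: "lam > 0"
    and phi_ineq: "\<forall>z\<in>einterval a b. deriv (deriv \<phi>) z + lam * (deriv \<phi> z)\<^sup>2 \<ge> 0"
    and height: "\<forall>p\<in>topspace S. \<psi> p $ 3 \<in> einterval a b"
    and minimal: "minimal_immersion \<phi> \<A> \<psi>"
    and gauss: "gauss_map \<A> \<psi> N"
    and H_nonpos: "\<forall>p\<in>topspace S. mean_curvature \<A> \<psi> N p \<le> 0"
    and H_vanishes: "\<exists>p\<in>surface_interior \<A>. mean_curvature \<A> \<psi> N p = 0"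
  shows "(\<forall>p\<in>topspace S. mean_curvature \<A> \<psi> N p = 0) \<and>
         (\<exists>P. vertical_plane P \<and> \<psi> ` topspace S \<subseteq> P)"
proof -
  interpret drift_minimal_surface S \<A> "einterval a b" \<phi> \<psi> N
    by standard (use surface phi_smooth height minimal gauss in auto)
  have "is_interval (einterval a b)"
    unfolding is_interval_1 by (auto simp: einterval_iff) (metis ereal_less_eq(3) order_less_le_trans order_le_less_trans)+
  then have pos: "deriv \<phi> z > 0" if "z \<in> einterval a b" for z
    using deriv_pos_if_exp_convex[of \<phi> "einterval a b" lam z] phi_smooth phi_increasing phi_ineq that
    unfolding smooth_on_def by auto
  have H: "mean_curvature \<A> \<psi> N p = - deriv \<phi> (\<psi> p $ 3) * (N p \<bullet> e3)" "deriv \<phi> (\<psi> p $ 3) > 0"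
    if "p \<in> topspace S" for p
    using mean_curvature_eq[OF that] pos height that by auto
  have nonneg: "N p \<bullet> e3 \<ge> 0" if "p \<in> topspace S" for p
    using H[OF that] H_nonpos that by (auto simp: zero_le_mult_iff)
  obtain z where z: "z \<in> surface_interior \<A>" "mean_curvature \<A> \<psi> N z = 0" using H_vanishes by blast
  obtain c where "c \<in> \<A>" "z \<in> fst c" using z(1) unfolding surface_interior_def by blast
  then have zS: "z \<in> topspace S" and Nz: "norm (N z) = 1"
    using chart_domain_subset gauss unfolding gauss_map_def by blast+
  have "N z \<bullet> e3 = 0" using H[OF zS] z(2) by simp
  then have zero: "N p \<bullet> e3 = 0" if "p \<in> topspace S" for p
    using angle_zero_everywhere[OF assms(2) nonneg z(1) _ that] by blast
  show ?thesis
  proof (intro conjI ballI exI[of _ "{x. N z \<bullet> x = N z \<bullet> \<psi> z}"])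
    show "mean_curvature \<A> \<psi> N p = 0" if "p \<in> topspace S" for p
      using H(1)[OF that] zero[OF that] by simp
    show "vertical_plane {x. N z \<bullet> x = N z \<bullet> \<psi> z}"
      unfolding vertical_plane_def using zero[OF zS] Nz by (metis norm_zero zero_neq_one)
    show "\<psi> ` topspace S \<subseteq> {x. N z \<bullet> x = N z \<bullet> \<psi> z}"
      using image_planar[OF assms(2) zero zS] by blast
  qed
qed

end
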